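(* Let $\mathcal E^{(n)}=\big(\mathcal X^{(n)},\mathcal B^{(n)},\mathcal P^{(n)}=\{\mathbb P^{(n)}_{\boldsymbol\tau,\eta}:\boldsymbol\tau\in\mathbb R^k,\eta\in\Upsilon\}\big)$, $n\in\mathbb N$, be a sequence of experiments converging weakly, in the Le Cam sense, to the experiment $\mathcal E=\big(\mathcal X,\mathcal B,\mathcal P=\{\mathbb P_{\boldsymbol\tau,\eta}:\boldsymbol\tau\in\mathbb R^k,\eta\in\Upsilon\}\big)$, and let $\mathcal E^{(n)}_{\mathbf 0}$ and $\mathcal E_{\mathbf 0}$ be the nuisance subexperiments corresponding to $\boldsymbol\tau=\mathbf 0$. Let $\mathcal B$ be countably generated. Assume that (i) $\mathcal E_{\mathbf 0}$ admits a minimal sufficient and boundedly complete $\sigma$-field $\mathcal B_{\rm suff}\subseteq\mathcal B$ and a unique maximal ancillary $\sigma$-field $\mathcal B^{\ddagger}\subseteq\mathcal B$ (equivalently, a unique ancillary $\sigma$-field $\mathcal B^{\ddagger}$ such that $\sigma(\mathcal B_{\rm suff}\cup\mathcal B^{\ddagger})=\mathcal B$); (ii) for each $n$, $\mathcal E^{(n)}_{\mathbf 0}$ admits a minimal sufficient and boundedly complete $\sigma$-field $\mathcal B^{(n)}_{\rm suff}\subseteq\mathcal B^{(n)}$ and a (not necessarily unique) maximal ancillary $\sigma$-field $\mathcal B^{\ddagger(n)}\subseteq\mathcal B^{(n)}$ (equivalently, an ancillary $\sigma$-field $\mathcal B^{\ddagger(n)}$ such that $\sigma(\mathcal B^{(n)}_{\rm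 suff}\cup\mathcal B^{\ddagger(n)})=\mathcal B^{(n)}$); (iii) $\mathcal B^{\ddagger(n)}$ converges $\mathcal E^{(n)}$-weakly to $\mathcal B^{\ddagger}$ as $n\to\infty$. Then the restriction $\big(\mathcal X^{(n)},\mathcal B^{\ddagger(n)},\mathcal P^{(n)}\big)$ of $\mathcal E^{(n)}$ to $\mathcal B^{\ddagger(n)}$ converges weakly, in the Le Cam sense, to the restriction $\big(\mathcal X,\mathcal B^{\ddagger},\mathcal P\big)$ of $\mathcal E$ to $\mathcal B^{\ddagger}$.
   Context: Here $\boldsymbol\tau\in\mathbb R^k$ is the (local) parameter of interest and $\eta$ the (local) nuisance, ranging over a separable infinite-dimensional vector space $\Upsilon$ with origin $0$. Within each experiment, all probability measures are mutually absolutely continuous. $\mathrm d\mathrm P/\mathrm d\mathrm Q$ denotes the Radon-Nikodym derivative of the component of $\mathrm P$ that is absolutely continuous with respect to $\mathrm Q$; $\stackrel{\mathcal L}{\longrightarrow}$ denotes convergence in distribution. Weak (Le Cam) convergence of $\mathcal E^{(n)}$ to $\mathcal E$: for every finite set $J$ of values $(\boldsymbol\tau,\eta)$, the vector of likelihood ratios $(\mathrm d\mathbb P^{(n)}_{\boldsymbol\tau,\eta}/\mathrm d\mathbb P^{(n)}_{\mathbf 0,0})_{(\boldsymbol\tau,\eta)\in J}$ under $\mathbb P^{(n)}_{\mathbf 0,0}$ converges in distribution to $(\mathrm d\mathbb P_{\boldsymbol\tau,\eta}/\mathrm d\mathbb P_{\mathbf 0,0})_{(\boldsymbol\tau,\eta)\in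 J}$ under $\mathbb P_{\mathbf 0,0}$. The restriction of an experiment to a sub-$\sigma$-field is the experiment in which all probability measures are restricted to that sub-$\sigma$-field (so that likelihood ratios are those of the restricted measures). Nuisance subexperiments: $\mathcal E^{(n)}_{\mathbf 0}=(\mathcal X^{(n)},\mathcal B^{(n)},\{\mathbb P^{(n)}_{\mathbf 0,\eta}:\eta\in\Upsilon\})$ and $\mathcal E_{\mathbf 0}=(\mathcal X,\mathcal B,\{\mathbb P_{\mathbf 0,\eta}:\eta\in\Upsilon\})$. In an experiment $(\Omega,\mathcal A,\mathcal Q)$, a sub-$\sigma$-field $\mathcal A_0$ is ancillary if $\mathrm P_1(A)=\mathrm P_2(A)$ for all $A\in\mathcal A_0$ and all $\mathrm P_1,\mathrm P_2\in\mathcal Q$; it is maximal ancillary if it is maximal among ancillary $\sigma$-fields for inclusion up to $\mathcal Q$-null sets; uniqueness is up to $\mathcal Q$-null sets (null sets are tacitly included in all maximal ancillary $\sigma$-fields). $\mathcal A_0$ is boundedly complete if, for every bounded $\mathcal A_0$-measurable random variable $\zeta$, $\mathbb E_{\mathrm P}\zeta=0$ for all $\mathrm P\in\mathcal Q$ implies $\zeta=0$ $\mathrm P$-a.s. for all $\mathrm P\in\mathcal Q$. A sequence $\xi_n$ of $\mathcal B^{(n)}$-measurable random variables converges $\mathcal E^{(n)}$-weakly to the $\mathcal B$-measurable random variable $\xi$ if, for every finite set $J$ of values $(\boldsymbol\tau,\eta)$, under $\mathbb P^{(n)}_{\mathbf 0,0}$, $\big((\mathrm d\mathbb P^{(n)}_{\boldsymbol\tau,\eta}/\mathrm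 d\mathbb P^{(n)}_{\mathbf 0,0})_{(\boldsymbol\tau,\eta)\in J},\,\xi_n\big)\stackrel{\mathcal L}{\longrightarrow}\big((\mathrm d\mathbb P_{\boldsymbol\tau,\eta}/\mathrm d\mathbb P_{\mathbf 0,0})_{(\boldsymbol\tau,\eta)\in J},\,\xi\big)$, the limit being considered under $\mathbb P_{\mathbf 0,0}$. A sequence $\mathcal A^{(n)}$ of sub-$\sigma$-fields of $\mathcal B^{(n)}$ converges $\mathcal E^{(n)}$-weakly to the sub-$\sigma$-field $\mathcal A$ of $\mathcal B$ if, for every $\mathcal A$-measurable random variable $\xi$, there exists a sequence $\xi_n$ of $\mathcal A^{(n)}$-measurable random variables converging $\mathcal E^{(n)}$-weakly to $\xi$. A $\sigma$-field is countably generated if it is generated by a countable family of uniformly bounded random variables (typically, indicators).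
   Formalization: The two formulations called equivalent in (i) and (ii) are not: maximal ancillarity does not imply σ(B_suff ∪ B‡) = B, and the claim fails without it. Both are assumed, in (i) and for each n in (ii); uniqueness in (i) is among ancillary fields that generate B jointly with B_suff. *)

theory Defs
  imports "HOL-Probability.Probability"
begin

(* Only the space and the sigma-field of B, and of every measure standing for a sub-sigma-field
   of B below, are ever used; the values of these measures are irrelevant.
   Mutual absolute continuity is part of the notion of experiment. *)
definition statistical_experiment :: "'a measure \<Rightarrow> ('i \<Rightarrow> 'a measure) \<Rightarrow> bool" where
  "statistical_experiment B P \<longleftrightarrow>
     (\<forall>i. prob_space (P i) \<and> sets (P i) = sets B) \<and>
     (\<forall>i j. absolutely_continuous (P i) (P j))"

(* dP/dQ. In an experiment P is absolutely continuous with respect to Q, so that the absolutely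
   continuous component of P is P itself. *)
definition likelihood_ratio :: "'a measure \<Rightarrow> 'a measure \<Rightarrow> 'a \<Rightarrow> real" where
  "likelihood_ratio P Q = (\<lambda>x. enn2real (RN_deriv Q P x))"

definition lr_vector :: "'i \<Rightarrow> ('i \<Rightarrow> 'a measure) \<Rightarrow> 'i set \<Rightarrow> 'a \<Rightarrow> 'i \<Rightarrow> real" where
  "lr_vector b P J = (\<lambda>x. \<lambda>i\<in>J. likelihood_ratio (P i) (P b) x)"

(* X n under M n converges in distribution, as random elements of the topological space T,
   to X under M. *)
definition conv_in_distribution ::
    "'c topology \<Rightarrow> (nat \<Rightarrow> 'a measure) \<Rightarrow> (nat \<Rightarrow> 'a \<Rightarrow> 'c) \<Rightarrow> 'b measure \<Rightarrow> ('b \<Rightarrow> 'c) \<Rightarrow> bool" where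
  "conv_in_distribution T Mn Xn M X \<longleftrightarrow>
     (\<forall>f. continuous_map T euclideanreal f \<and> bounded (f ` topspace T) \<longrightarrow>
        (\<lambda>n. \<integral>x. f (Xn n x) \<partial>(Mn n)) \<longlonglongrightarrow> (\<integral>x. f (X x) \<partial>M))"

(* b is the base point of the index set. For finite J, powertop_real J is Euclidean space R^J. *)
definition le_cam_conv :: "'i \<Rightarrow> (nat \<Rightarrow> 'i \<Rightarrow> 'a measure) \<Rightarrow> ('i \<Rightarrow> 'b measure) \<Rightarrow> bool" where
  "le_cam_conv b Pn P \<longleftrightarrow>
     (\<forall>J. finite J \<longrightarrow>
        conv_in_distribution (powertop_real J)
          (\<lambda>n. Pn n b) (\<lambda>n. lr_vector b (Pn n) J) (P b) (lr_vector b P J))"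

definition rv_conv ::
    "'i \<Rightarrow> (nat \<Rightarrow> 'i \<Rightarrow> 'a measure) \<Rightarrow> ('i \<Rightarrow> 'b measure) \<Rightarrow> (nat \<Rightarrow> 'a \<Rightarrow> real) \<Rightarrow> ('b \<Rightarrow> real) \<Rightarrow> bool" where
  "rv_conv b Pn P \<xi>n \<xi> \<longleftrightarrow>
     (\<forall>J. finite J \<longrightarrow>
        conv_in_distribution (prod_topology (powertop_real J) euclideanreal)
          (\<lambda>n. Pn n b) (\<lambda>n x. (lr_vector b (Pn n) J x, \<xi>n n x))
          (P b) (\<lambda>x. (lr_vector b P J x, \<xi> x)))"

definition sigma_field_conv ::
    "'i \<Rightarrow> (nat \<Rightarrow> 'i \<Rightarrow> 'a measure) \<Rightarrow> ('i \<Rightarrow> 'b measure) \<Rightarrow> (nat \<Rightarrow> 'a measure) \<Rightarrow> 'b measure \<Rightarrow> bool" where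
  "sigma_field_conv b Pn P An A \<longleftrightarrow>
     (\<forall>\<xi> :: 'b \<Rightarrow> real. \<xi> \<in> borel_measurable A \<longrightarrow>
        (\<exists>\<xi>n. (\<forall>n. \<xi>n n \<in> borel_measurable (An n)) \<and> rv_conv b Pn P \<xi>n \<xi>))"

definition restriction :: "('i \<Rightarrow> 'a measure) \<Rightarrow> 'a measure \<Rightarrow> 'i \<Rightarrow> 'a measure" where
  "restriction P A = (\<lambda>i. restr_to_subalg (P i) A)"

definition family_null_sets :: "'a measure \<Rightarrow> ('i \<Rightarrow> 'a measure) \<Rightarrow> 'a set set" where
  "family_null_sets B Q = {N \<in> sets B. \<forall>i. emeasure (Q i) N = 0}"

definition subset_mod_null ::
    "'a measure \<Rightarrow> ('i \<Rightarrow> 'a measure) \<Rightarrow> 'a measure \<Rightarrow> 'a measure \<Rightarrow> bool" where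
  "subset_mod_null B Q A A' \<longleftrightarrow>
     (\<forall>U\<in>sets A. \<exists>V\<in>sets A'. sym_diff U V \<in> family_null_sets B Q)"

definition eq_mod_null ::
    "'a measure \<Rightarrow> ('i \<Rightarrow> 'a measure) \<Rightarrow> 'a measure \<Rightarrow> 'a measure \<Rightarrow> bool" where
  "eq_mod_null B Q A A' \<longleftrightarrow> subset_mod_null B Q A A' \<and> subset_mod_null B Q A' A"

(* One and the same function g is a version of the conditional probability of U given S
   under every member of the family. *)
definition sufficient :: "'a measure \<Rightarrow> ('i \<Rightarrow> 'a measure) \<Rightarrow> 'a measure \<Rightarrow> bool" where
  "sufficient B Q S \<longleftrightarrow> subalgebra B S \<and>
     (\<forall>U\<in>sets B. \<exists>g \<in> borel_measurable S. \<forall>i.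
        AE x in Q i. g x = real_cond_exp (Q i) S (indicator U) x)"

definition minimal_sufficient :: "'a measure \<Rightarrow> ('i \<Rightarrow> 'a measure) \<Rightarrow> 'a measure \<Rightarrow> bool" where
  "minimal_sufficient B Q S \<longleftrightarrow>
     sufficient B Q S \<and> (\<forall>S'. sufficient B Q S' \<longrightarrow> subset_mod_null B Q S S')"

definition boundedly_complete :: "'a measure \<Rightarrow> ('i \<Rightarrow> 'a measure) \<Rightarrow> 'a measure \<Rightarrow> bool" where
  "boundedly_complete B Q A \<longleftrightarrow> subalgebra B A \<and>
     (\<forall>\<zeta> :: 'a \<Rightarrow> real. \<zeta> \<in> borel_measurable A \<and> bounded (\<zeta> ` space A) \<and>
        (\<forall>i. (\<integral>x. \<zeta> x \<partial>(Q i)) = 0) \<longrightarrow> (\<forall>i. AE x in Q i. \<zeta> x = 0))"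

definition ancillary :: "'a measure \<Rightarrow> ('i \<Rightarrow> 'a measure) \<Rightarrow> 'a measure \<Rightarrow> bool" where
  "ancillary B Q A \<longleftrightarrow> subalgebra B A \<and>
     (\<forall>U\<in>sets A. \<forall>i j. measure (Q i) U = measure (Q j) U)"

(* By convention a maximal ancillary sigma-field contains the null sets of the family. *)
definition maximal_ancillary :: "'a measure \<Rightarrow> ('i \<Rightarrow> 'a measure) \<Rightarrow> 'a measure \<Rightarrow> bool" where
  "maximal_ancillary B Q A \<longleftrightarrow> ancillary B Q A \<and> family_null_sets B Q \<subseteq> sets A \<and>
     (\<forall>A'. ancillary B Q A' \<and> subset_mod_null B Q A A' \<longrightarrow> subset_mod_null B Q A' A)"

definition jointly_generate :: "'a measure \<Rightarrow> 'a measure \<Rightarrow> 'a measure \<Rightarrow> bool" where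
  "jointly_generate B S A \<longleftrightarrow> sigma_sets (space B) (sets S \<union> sets A) = sets B"

definition countably_generated :: "'a measure \<Rightarrow> bool" where
  "countably_generated B \<longleftrightarrow>
     (\<exists>(f :: nat \<Rightarrow> 'a \<Rightarrow> real) C. (\<forall>m. \<forall>x\<in>space B. \<bar>f m x\<bar> \<le> C) \<and>
        sets B = sigma_sets (space B) {f m -` U \<inter> space B | m U. U \<in> sets borel})"

(* A separable infinite-dimensional real topological vector space. There is no type class
   of real topological vector spaces, hence the explicit continuity conditions. *)
definition separable_inf_dim_tvs ::
    "'u::{real_vector,topological_space} itself \<Rightarrow> bool" where
  "separable_inf_dim_tvs (_ :: 'u itself) \<longleftrightarrow>
     continuous_on UNIV (\<lambda>(x :: 'u, y). x + y) \<and>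
     continuous_on UNIV (\<lambda>(c :: real, x :: 'u). c *\<^sub>R x) \<and>
     separable_space (euclidean :: 'u topology) \<and>
     \<not> (\<exists>b :: 'u set. finite b \<and> span b = UNIV)"

end

(* Write L_i = dP_i/dP_b, and let T collect the likelihood ratios of the nuisance subexperiment.
   Sufficiency makes T measurable with respect to the sufficient sigma-field, so by Basu's theorem T is
   independent of the ancillary sigma-field, along the sequence and in the limit. In the limit,
   minimality puts the sufficient sigma-field inside sigma(T) up to null sets; since it generates,
   together with the ancillary sigma-field A, the whole of B, every L_i is within epsilon in L1 of a
   finite sum of terms h(T) phi(xi), with h and phi continuous and bounded and one A-measurable xi.
   Take A^(n)-measurable xi_n converging weakly to xi. The L1 error passes to the prelimit, and
   conditioning on A^(n) only integrates h(T_n) out of the sum, by independence. Hence the restricted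
   likelihood ratios are L1-close, along the sequence and in the limit, to one and the same continuous
   function of xi_n and xi respectively, which gives convergence of the expectations of bounded
   Lipschitz functions. *)

theory Submission
  imports Defs
begin

subsection \<open>Experiments and likelihood ratios\<close>

text \<open>A restricted likelihood ratio is a conditional expectation, in general not a continuous
  function of the likelihood ratios and ancillary variables, so joint weak convergence does not
  carry over to it directly. Independence turns it into a combination with deterministic
  coefficients E h(T_n), and these converge as means of bounded continuous functions of finitely
  many likelihood ratios. The L1 error is not the mean of a bounded test function either. Truncating
  L_i at a level c repairs this; the tails are under control because likelihood ratios are
  nonnegative with mean exactly one, no mass being lost between mutually absolutely continuous
  measures. That \<open>S\<close> lies in sigma(T) up to null sets rests on sigma(T) being itself
  sufficient. Finally, L1 estimates only serve Lipschitz test functions, so the bounded continuous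
  ones are reached from below by an inf-convolution.\<close>

lemma statistical_experimentD:
  assumes "statistical_experiment B P"
  shows "prob_space (P i)" "sets (P i) = sets B" "space (P i) = space B"
    "absolutely_continuous (P i) (P j)"
  using assms sets_eq_imp_space_eq[of "P i" B] unfolding statistical_experiment_def by auto

lemma statistical_experiment_comp:
  "statistical_experiment B P \<Longrightarrow> statistical_experiment B (\<lambda>j. P (\<nu> j))"
  by (auto simp: statistical_experiment_def)

lemma measurable_experimentI:
  assumes "statistical_experiment B P" "f \<in> measurable B N"
  shows "f \<in> measurable (P i) N"
  using assms(2) measurable_cong_sets[OF statistical_experimentD(2)[OF assms(1), of i] refl, of N]
  by simp

lemma subalgebra_experiment:
  assumes "statistical_experiment B P" "subalgebra B A"
  shows "subalgebra (P i) A"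
  using assms statistical_experimentD[OF assms(1)] by (simp add: subalgebra_def)

lemma finite_measure_subalgebra_experiment:
  assumes "statistical_experiment B P" "subalgebra B A"
  shows "finite_measure_subalgebra (P i) A"
proof -
  interpret prob_space "P i" using statistical_experimentD[OF assms(1)] by auto
  show ?thesis
    by unfold_locales (use subalgebra_experiment[OF assms] in auto)
qed

lemma integrable_experiment:
  fixes Z :: "'a \<Rightarrow> real"
  assumes "statistical_experiment B P" "Z \<in> borel_measurable B" "\<And>x. \<bar>Z x\<bar> \<le> C"
  shows "integrable (P i) Z"
proof -
  interpret prob_space "P i" using statistical_experimentD[OF assms(1)] by auto
  show ?thesis
    by (rule integrable_const_bound[where B = C])
      (use assms measurable_experimentI[OF assms(1,2)] in auto)
qed

lemma measurable_likelihood_ratio [measurable]: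
  assumes "statistical_experiment B P"
  shows "likelihood_ratio (P i) (P b) \<in> borel_measurable B"
proof -
  have "likelihood_ratio (P i) (P b) \<in> borel_measurable (P b)"
    unfolding likelihood_ratio_def by measurable
  then show ?thesis
    by (subst measurable_cong_sets[OF statistical_experimentD(2)[OF assms, of b, symmetric] refl])
qed

lemma likelihood_ratio_nonneg: "0 \<le> likelihood_ratio M N x"
  by (simp add: likelihood_ratio_def)

text \<open>The Radon-Nikodym derivative of a probability measure is finite almost everywhere, so
  passing to real values with \<open>enn2real\<close> alters it on a null set only.\<close>

lemma density_likelihood_ratio:
  assumes "statistical_experiment B P"
  shows "density (P b) (\<lambda>x. ennreal (likelihood_ratio (P i) (P b) x)) = P i"
proof -
  note D = statistical_experimentD[OF assms]
  interpret b: prob_space "P b" by (rule D)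
  interpret i: prob_space "P i" by (rule D)
  have "AE x in P b. RN_deriv (P b) (P i) x \<noteq> \<infinity>"
    by (rule b.RN_deriv_finite) (auto simp: D i.sigma_finite_measure_axioms)
  then have "AE x in P b. ennreal (likelihood_ratio (P i) (P b) x) = RN_deriv (P b) (P i) x"
    by eventually_elim (simp add: likelihood_ratio_def less_top)
  then have "density (P b) (\<lambda>x. ennreal (likelihood_ratio (P i) (P b) x))
      = density (P b) (RN_deriv (P b) (P i))"
    by (rule density_cong[rotated 2])
      (rule measurable_compose[OF _ measurable_ennreal] borel_measurable_RN_deriv
        measurable_experimentI[OF assms] measurable_likelihood_ratio[OF assms])+
  also have "\<dots> = P i"
    by (rule b.density_RN_deriv) (auto simp: D)
  finally show ?thesis .
qed

lemma integrable_likelihood_ratio_iff: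
  fixes Z :: "'a \<Rightarrow> real"
  assumes "statistical_experiment B P" "Z \<in> borel_measurable B"
  shows "integrable (P b) (\<lambda>x. likelihood_ratio (P i) (P b) x * Z x) \<longleftrightarrow> integrable (P i) Z"
proof -
  have "integrable (density (P b) (\<lambda>x. ennreal (likelihood_ratio (P i) (P b) x))) Z
      \<longleftrightarrow> integrable (P b) (\<lambda>x. likelihood_ratio (P i) (P b) x *\<^sub>R Z x)"
    by (rule integrable_density[OF measurable_experimentI[OF assms] _ AE_I2[OF likelihood_ratio_nonneg]])
      (rule measurable_experimentI[OF assms(1)] measurable_likelihood_ratio[OF assms(1)] assms(2))+
  then show ?thesis
    by (simp add: density_likelihood_ratio[OF assms(1)])
qed

lemma integral_likelihood_ratio:
  fixes Z :: "'a \<Rightarrow> real"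
  assumes "statistical_experiment B P" "Z \<in> borel_measurable B"
  shows "(\<integral>x. likelihood_ratio (P i) (P b) x * Z x \<partial>P b) = (\<integral>x. Z x \<partial>P i)"
proof -
  have "(\<integral>x. Z x \<partial>density (P b) (\<lambda>x. ennreal (likelihood_ratio (P i) (P b) x)))
      = (\<integral>x. likelihood_ratio (P i) (P b) x *\<^sub>R Z x \<partial>P b)"
    by (rule integral_density[OF measurable_experimentI[OF assms] _ AE_I2[OF likelihood_ratio_nonneg]])
      (rule measurable_experimentI[OF assms(1)] measurable_likelihood_ratio[OF assms(1)] assms(2))+
  then show ?thesis
    by (simp add: density_likelihood_ratio[OF assms(1)])
qed

lemma integrable_likelihood_ratio:
  assumes "statistical_experiment B P"
  shows "integrable (P b) (likelihood_ratio (P i) (P b))"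
proof -
  have "integrable (P b) (\<lambda>x. likelihood_ratio (P i) (P b) x * 1)"
    by (rule integrable_likelihood_ratio_iff[OF assms, THEN iffD2])
      (auto intro!: integrable_experiment[OF assms, where C = 1])
  then show ?thesis by simp
qed

lemma integral_likelihood_ratio_1:
  assumes "statistical_experiment B P"
  shows "(\<integral>x. likelihood_ratio (P i) (P b) x \<partial>P b) = 1"
  using integral_likelihood_ratio[OF assms borel_measurable_const[where c = 1], of b i]
    prob_space.prob_space[OF statistical_experimentD(1)[OF assms], of i] by simp

section \<open>Restriction of an experiment to a sub-sigma-field\<close>

lemma statistical_experiment_restriction:
  assumes "statistical_experiment B P" "subalgebra B A"
  shows "statistical_experiment A (restriction P A)"
proof -
  note D = statistical_experimentD[OF assms(1)]
  note sub = subalgebra_experiment[OF assms]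
  show ?thesis
    using D sub unfolding statistical_experiment_def restriction_def
    by (auto simp: sets_restr_to_subalg absolutely_continuous_def null_sets_restr_to_subalg subset_iff
        intro!: prob_space_restr_to_subalg)
qed

lemma integral_restriction:
  fixes Z :: "'a \<Rightarrow> real"
  assumes "statistical_experiment B P" "subalgebra B A" "Z \<in> borel_measurable A"
  shows "(\<integral>x. Z x \<partial>restriction P A i) = (\<integral>x. Z x \<partial>P i)"
  unfolding restriction_def
  by (rule integral_subalgebra2[OF subalgebra_experiment[OF assms(1,2)] assms(3)])

lemma integrable_restriction:
  fixes Z :: "'a \<Rightarrow> real"
  assumes "statistical_experiment B P" "subalgebra B A" "integrable (restriction P A i) Z"
  shows "integrable (P i) Z"
  using integrable_from_subalg[OF subalgebra_experiment[OF assms(1,2)]] assms(3)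
  unfolding restriction_def by auto

text \<open>The left factor is a version of the conditional expectation of the right one.\<close>

lemma integral_likelihood_ratio_restriction:
  fixes Z :: "'a \<Rightarrow> real"
  assumes "statistical_experiment B P" "subalgebra B A" "Z \<in> borel_measurable A"
  shows "(\<integral>x. likelihood_ratio (restriction P A i) (restriction P A b) x * Z x \<partial>P b)
    = (\<integral>x. likelihood_ratio (P i) (P b) x * Z x \<partial>P b)"
proof -
  note E = statistical_experiment_restriction[OF assms(1,2)]
  have "(\<integral>x. likelihood_ratio (restriction P A i) (restriction P A b) x * Z x \<partial>P b)
    = (\<integral>x. likelihood_ratio (restriction P A i) (restriction P A b) x * Z x \<partial>restriction P A b)"
    by (rule integral_restriction[symmetric, OF assms(1,2)])
      (intro borel_measurable_times measurable_likelihood_ratio[OF E] assms(3))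
  also have "\<dots> = (\<integral>x. Z x \<partial>restriction P A i)"
    by (rule integral_likelihood_ratio[OF E assms(3)])
  also have "\<dots> = (\<integral>x. Z x \<partial>P i)"
    by (rule integral_restriction[OF assms])
  also have "\<dots> = (\<integral>x. likelihood_ratio (P i) (P b) x * Z x \<partial>P b)"
    by (rule integral_likelihood_ratio[symmetric, OF assms(1) measurable_from_subalg[OF assms(2,3)]])
  finally show ?thesis .
qed

lemma integral_eq_imp_AE_eq:
  fixes f g :: "'a \<Rightarrow> real"
  assumes "integrable M f" "integrable M g"
    "\<And>U. U \<in> sets M \<Longrightarrow> (\<integral>x. f x * indicator U x \<partial>M) = (\<integral>x. g x * indicator U x \<partial>M)"
  shows "AE x in M. f x = g x"
  by (rule density_unique_real[OF assms(1,2)])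
    (use assms(3) in \<open>simp add: set_lebesgue_integral_def mult.commute\<close>)

subsection \<open>Sufficiency and Basu's theorem\<close>

text \<open>Conditional probabilities lie in [0,1] almost surely under every member. Clamping the
  common version to this interval keeps it a version for the whole family and makes it bounded at
  every point, as bounded completeness demands.\<close>

lemma sufficientE:
  fixes Q :: "'j \<Rightarrow> 'a measure"
  assumes E: "statistical_experiment B Q" and "sufficient B Q S" "U \<in> sets B"
  obtains g :: "'a \<Rightarrow> real" where "g \<in> borel_measurable S" "\<And>x. \<bar>g x\<bar> \<le> 1"
    "\<And>j. AE x in Q j. g x = real_cond_exp (Q j) S (indicator U) x"
proof -
  have sub: "subalgebra B S" using assms(2) by (simp add: sufficient_def)
  obtain g0 where g0: "g0 \<in> borel_measurable S"
    "\<And>j. AE x in Q j. g0 x = real_cond_exp (Q j) S (indicator U) x"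
    using assms(2,3) unfolding sufficient_def by blast
  define g where "g x = max 0 (min 1 (g0 x))" for x
  show thesis
  proof
    show "g \<in> borel_measurable S" unfolding g_def using g0(1) by measurable
    show "\<bar>g x\<bar> \<le> 1" for x by (auto simp: g_def)
    fix j
    interpret j: finite_measure_subalgebra "Q j" S
      by (rule finite_measure_subalgebra_experiment[OF E sub])
    have Uj [measurable]: "U \<in> sets (Q j)" using assms(3) statistical_experimentD[OF E] by auto
    have "AE x in Q j. real_cond_exp (Q j) S (indicator U) x \<ge> 0"
      by (rule j.real_cond_exp_pos) auto
    moreover have "AE x in Q j. real_cond_exp (Q j) S (indicator U) x \<le> 1"
      by (rule j.real_cond_exp_le_c) (auto intro: j.integrable_const_bound[where B=1])
    ultimately show "AE x in Q j. g x = real_cond_exp (Q j) S (indicator U) x"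
      using g0(2)[of j] by eventually_elim (auto simp: g_def)
  qed
qed

text \<open>One half of the factorisation criterion: the likelihood ratio L equals its conditional
  expectation l given \<open>S\<close> under \<open>Q b\<close>. For an event U with common version
  g, one has Q_i(U) = E_i g = E_b (L g) = E_b (l g) = E_b (l 1_U), and U is arbitrary.\<close>

lemma likelihood_ratio_sufficient_version:
  fixes Q :: "'j \<Rightarrow> 'a measure"
  assumes E: "statistical_experiment B Q" and "sufficient B Q S"
  obtains l where "l \<in> borel_measurable S" "AE x in Q b. likelihood_ratio (Q i) (Q b) x = l x"
proof
  have sub: "subalgebra B S" using assms(2) by (simp add: sufficient_def)
  note mS = measurable_from_subalg[OF sub]
  interpret b: finite_measure_subalgebra "Q b" S
    by (rule finite_measure_subalgebra_experiment[OF E sub])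
  interpret i: finite_measure_subalgebra "Q i" S
    by (rule finite_measure_subalgebra_experiment[OF E sub])
  let ?L = "likelihood_ratio (Q i) (Q b)"
  let ?l = "real_cond_exp (Q b) S ?L"
  show "?l \<in> borel_measurable S" by simp
  have mL [measurable]: "?L \<in> borel_measurable (Q b)"
    using integrable_likelihood_ratio[OF E] by auto
  show "AE x in Q b. ?L x = ?l x"
  proof (rule integral_eq_imp_AE_eq)
    show "integrable (Q b) ?L" by (rule integrable_likelihood_ratio[OF E])
    then show "integrable (Q b) ?l" by (rule b.real_cond_exp_int)
    fix U assume "U \<in> sets (Q b)"
    then have U: "U \<in> sets B" using statistical_experimentD[OF E] by auto
    obtain g where gS [measurable]: "g \<in> borel_measurable S" and gbd: "\<And>x. \<bar>g x\<bar> \<le> 1"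
      and g: "\<And>j. AE x in Q j. g x = real_cond_exp (Q j) S (indicator U) x"
      using sufficientE[OF E assms(2) U] by metis
    have gB: "g \<in> borel_measurable B" by (rule mS[OF gS])
    have gQ: "g \<in> borel_measurable (Q j)" for j
      by (rule measurable_experimentI[OF E gB])
    have iU: "integrable (Q j) (indicator U :: _ \<Rightarrow> real)" for j
      by (rule integrable_experiment[OF E, where C = 1]) (use U in auto)
    have Ub [measurable]: "U \<in> sets (Q b)" by fact
    have iLg: "integrable (Q b) (\<lambda>x. ?L x * g x)"
      using integrable_likelihood_ratio_iff[OF E gB] integrable_experiment[OF E gB gbd] by auto
    have "(\<integral>x. ?L x * indicator U x \<partial>Q b) = (\<integral>x. indicator U x \<partial>Q i)"
      by (rule integral_likelihood_ratio[OF E]) (use U in auto)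
    also have "\<dots> = (\<integral>x. real_cond_exp (Q i) S (indicator U) x \<partial>Q i)"
      by (rule i.real_cond_exp_int(2)[symmetric]) (rule iU)
    \<comment> \<open>Sufficiency links the two measures: the same g is a version under
      \<open>Q i\<close> here and under \<open>Q b\<close> three steps below.\<close>
    also have "\<dots> = (\<integral>x. g x \<partial>Q i)"
      by (rule integral_cong_AE[OF _ _ AE_symmetric[OF g]])
        (rule gQ borel_measurable_cond_exp2)+
    also have "\<dots> = (\<integral>x. ?L x * g x \<partial>Q b)"
      by (rule integral_likelihood_ratio[symmetric, OF E gB])
    also have "\<dots> = (\<integral>x. g x * ?L x \<partial>Q b)" by (simp add: mult.commute)
    also have "\<dots> = (\<integral>x. g x * ?l x \<partial>Q b)"
      by (rule b.real_cond_exp_intg(2)[symmetric]) (use iLg in \<open>auto simp: mult.commute\<close>)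
    also have "\<dots> = (\<integral>x. ?l x * real_cond_exp (Q b) S (indicator U) x \<partial>Q b)"
      by (rule integral_cong_AE)
        (use g[of b] gQ in \<open>auto intro!: borel_measurable_times\<close>)
    also have "\<dots> = (\<integral>x. ?l x * indicator U x \<partial>Q b)"
      by (rule b.real_cond_exp_intg(2))
        (use integrable_real_mult_indicator[OF Ub b.real_cond_exp_int(1)[OF integrable_likelihood_ratio[OF E]]]
         in auto)
    finally show "(\<integral>x. ?L x * indicator U x \<partial>Q b) = (\<integral>x. ?l x * indicator U x \<partial>Q b)" .
  qed
qed

text \<open>Given \<open>S\<close>, an ancillary event has constant conditional probability, hence
  it is uncorrelated with every bounded \<open>S\<close>-measurable variable. Independence is
  expressed through products of bounded variables, the form in which it is applied.\<close>

lemma basu: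
  fixes Q :: "'j \<Rightarrow> 'a measure" and Y Z :: "'a \<Rightarrow> real"
  assumes E: "statistical_experiment B Q" and suff: "sufficient B Q S"
    and compl: "boundedly_complete B Q S" and anc: "ancillary B Q A"
    and Y: "Y \<in> borel_measurable S" "\<And>x. \<bar>Y x\<bar> \<le> C"
    and Z: "Z \<in> borel_measurable A" "\<And>x. \<bar>Z x\<bar> \<le> D"
  shows "(\<integral>x. Y x * Z x \<partial>Q b) = (\<integral>x. Y x \<partial>Q b) * (\<integral>x. Z x \<partial>Q b)"
proof -
  note D = statistical_experimentD[OF E]
  have sub: "subalgebra B S" using suff by (simp add: sufficient_def)
  have subA: "subalgebra B A" using anc by (simp add: ancillary_def)
  note mS = measurable_from_subalg[OF sub] and mA = measurable_from_subalg[OF subA]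
  interpret b: prob_space "Q b" by (rule D)
  interpret b: finite_measure_subalgebra "Q b" S
    by (rule finite_measure_subalgebra_experiment[OF E sub])
  interpret bA: finite_measure_subalgebra "Q b" A
    by (rule finite_measure_subalgebra_experiment[OF E subA])
  have iY: "integrable (Q b) Y" by (rule integrable_experiment[OF E mS[OF Y(1)] Y(2)])
  have iZ: "integrable (Q b) Z" by (rule integrable_experiment[OF E mA[OF Z(1)] Z(2)])
  have YU: "(\<integral>x. Y x * indicator U x \<partial>Q b) = (\<integral>x. Y x \<partial>Q b) * measure (Q b) U"
    if UA: "U \<in> sets A" for U
  proof -
    have U: "U \<in> sets B" using UA subA by (auto simp: subalgebra_def)
    define c where "c = measure (Q b) U"
    have c: "measure (Q j) U = c" for j using anc UA by (auto simp: ancillary_def c_def)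
    obtain g where gS [measurable]: "g \<in> borel_measurable S" and gbd: "\<And>x. \<bar>g x\<bar> \<le> 1"
      and g: "\<And>j. AE x in Q j. g x = real_cond_exp (Q j) S (indicator U) x"
      using sufficientE[OF E suff U] by metis
    have gB: "g \<in> borel_measurable B" by (rule mS[OF gS])
    have iU: "integrable (Q j) (indicator U :: _ \<Rightarrow> real)" for j
      by (rule integrable_experiment[OF E, where C = 1]) (use U in auto)
    \<comment> \<open>By ancillarity c is the mean of g under every member, so g - c is bounded,
      \<open>S\<close>-measurable and centred throughout the family; completeness then forces g = c
      almost surely.\<close>
    have "(\<integral>x. g x - c \<partial>Q j) = 0" for j
    proof -
      interpret j: prob_space "Q j" by (rule D)
      interpret j: finite_measure_subalgebra "Q j" S
        by (rule finite_measure_subalgebra_experiment[OF E sub])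
      have "(\<integral>x. g x \<partial>Q j) = (\<integral>x. real_cond_exp (Q j) S (indicator U) x \<partial>Q j)"
        by (rule integral_cong_AE[OF _ _ g])
          (rule measurable_experimentI[OF E gB] borel_measurable_cond_exp2)+
      also have "\<dots> = (\<integral>x. indicator U x \<partial>Q j)"
        by (rule j.real_cond_exp_int(2)) (rule iU)
      also have "\<dots> = c" using c[of j] U D by simp
      finally show ?thesis
        using integrable_experiment[OF E gB gbd] by (simp add: j.prob_space)
    qed
    moreover have "bounded ((\<lambda>x. g x - c) ` space S)"
    proof (rule boundedI)
      fix y assume "y \<in> (\<lambda>x. g x - c) ` space S"
      then obtain x where "y = g x - c" by blast
      then show "norm y \<le> 1 + \<bar>c\<bar>" using gbd[of x] by auto
    qed
    moreover have "(\<lambda>x. g x - c) \<in> borel_measurable S" by measurable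
    ultimately have "\<forall>j. AE x in Q j. g x - c = 0"
      by (intro mp[OF spec[OF conjunct2[OF compl[unfolded boundedly_complete_def]]]] conjI allI)
    then have "AE x in Q b. g x - c = 0" ..
    then have gc: "AE x in Q b. real_cond_exp (Q b) S (indicator U) x = c"
      using g[of b] by eventually_elim simp
    have Ub: "U \<in> sets (Q b)" using U D by simp
    have "(\<integral>x. Y x * indicator U x \<partial>Q b) = (\<integral>x. Y x * real_cond_exp (Q b) S (indicator U) x \<partial>Q b)"
      by (rule b.real_cond_exp_intg(2)[symmetric, OF integrable_real_mult_indicator[OF Ub iY] Y(1)])
        (use Ub in measurable)
    also have "\<dots> = (\<integral>x. Y x * c \<partial>Q b)"
    proof (rule integral_cong_AE)
      show "AE x in Q b. Y x * real_cond_exp (Q b) S (indicator U) x = Y x * c"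
        using gc by eventually_elim simp
    qed (use iY in \<open>auto intro!: borel_measurable_times\<close>)
    finally show ?thesis by (simp add: c_def)
  qed
  \<comment> \<open>Passage from events to Z: the centred Y integrates to 0 over every event of
    \<open>A\<close>, so its conditional expectation given \<open>A\<close> vanishes, and
    multiplying by Z keeps the mean at 0.\<close>
  define y where "y = (\<integral>x. Y x \<partial>Q b)"
  have i0: "integrable (Q b) (\<lambda>x. Y x - y)" using iY by auto
  have "AE x in Q b. real_cond_exp (Q b) A (\<lambda>x. Y x - y) x = 0"
  proof (rule bA.real_cond_exp_charact)
    fix U assume U: "U \<in> sets A"
    then have Ub: "U \<in> sets (Q b)" using subA D by (auto simp: subalgebra_def)
    have "(\<integral>x. Y x * indicator U x - y * indicator U x \<partial>Q b) = 0"
      using YU[OF U] integrable_real_mult_indicator[OF Ub iY] Ub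
      by (subst Bochner_Integration.integral_diff) (auto simp: y_def b.emeasure_eq_measure)
    then show "(\<integral>x\<in>U. Y x - y \<partial>Q b) = (\<integral>x\<in>U. 0 \<partial>Q b)"
      by (simp add: set_lebesgue_integral_def algebra_simps)
  qed (use i0 in auto)
  have iYZ: "integrable (Q b) (\<lambda>x. Y x * Z x)"
  proof (rule integrable_experiment[OF E, where C = "C * D"])
    show "\<bar>Y x * Z x\<bar> \<le> C * D" for x
      unfolding abs_mult by (intro mult_mono Y Z) (use Y(2)[of x] in auto)
  qed (use mS[OF Y(1)] mA[OF Z(1)] in auto)
  have "(\<integral>x. Z x * (Y x - y) \<partial>Q b) = (\<integral>x. Z x * real_cond_exp (Q b) A (\<lambda>x. Y x - y) x \<partial>Q b)"
    by (rule bA.real_cond_exp_intg(2)[symmetric])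
      (use iYZ iZ i0 Z in \<open>auto simp: algebra_simps\<close>)
  also have "\<dots> = (\<integral>x. 0 \<partial>Q b)"
    by (rule integral_cong_AE)
      (use \<open>AE x in Q b. _ = 0\<close> measurable_experimentI[OF E mA[OF Z(1)]]
        in \<open>auto intro!: borel_measurable_times\<close>)
  finally have "(\<integral>x. Z x * (Y x - y) \<partial>Q b) = 0" by simp
  moreover have "(\<integral>x. Z x * (Y x - y) \<partial>Q b) = (\<integral>x. Y x * Z x \<partial>Q b) - y * (\<integral>x. Z x \<partial>Q b)"
    using iYZ iZ by (simp add: algebra_simps)
  ultimately show ?thesis by (simp add: y_def)
qed

subsection \<open>Approximation by nuisance likelihood ratios and ancillary events\<close>

text \<open>The algebra generated by the constants and the bounded continuous functions of single
  coordinates in \<open>N\<close>. A member involves finitely many coordinates even for infinite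
  \<open>N\<close>, and its boundedness, continuity and measurability follow by induction on its
  construction.\<close>

inductive cylindrical :: "'i set \<Rightarrow> (('i \<Rightarrow> real) \<Rightarrow> real) \<Rightarrow> bool" for N where
  const: "cylindrical N (\<lambda>t. c)"
| coord: "i \<in> N \<Longrightarrow> continuous_on UNIV \<phi> \<Longrightarrow> (\<And>y. \<bar>\<phi> y\<bar> \<le> C) \<Longrightarrow> cylindrical N (\<lambda>t. \<phi> (t i))"
| add: "cylindrical N h \<Longrightarrow> cylindrical N h' \<Longrightarrow> cylindrical N (\<lambda>t. h t + h' t)"
| mult: "cylindrical N h \<Longrightarrow> cylindrical N h' \<Longrightarrow> cylindrical N (\<lambda>t. h t * h' t)"

lemma cylindrical_bounded: "cylindrical N h \<Longrightarrow> \<exists>C. \<forall>t. \<bar>h t\<bar> \<le> C"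
proof (induction rule: cylindrical.induct)
  case (add h h')
  then obtain C D where "\<forall>t. \<bar>h t\<bar> \<le> C" "\<forall>t. \<bar>h' t\<bar> \<le> D" by auto
  then show ?case by (intro exI[of _ "C + D"]) (auto intro: order_trans[OF abs_triangle_ineq] add_mono)
next
  case (mult h h')
  then obtain C D where "\<forall>t. \<bar>h t\<bar> \<le> C" "\<forall>t. \<bar>h' t\<bar> \<le> D" by auto
  then show ?case
    by (intro exI[of _ "C * D"]) (auto simp: abs_mult intro: mult_mono order_trans[OF abs_ge_zero])
qed auto

lemma cylindrical_mono: "cylindrical N h \<Longrightarrow> N \<subseteq> N' \<Longrightarrow> cylindrical N' h"
  by (induction rule: cylindrical.induct) (auto intro: cylindrical.intros)

text \<open>Weak convergence concerns finitely many likelihood ratios at a time, while approximation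
  takes place over the whole nuisance index set; this isolates the coordinates that matter.\<close>

lemma cylindrical_finite: "cylindrical N h \<Longrightarrow> \<exists>J. finite J \<and> J \<subseteq> N \<and> cylindrical J h"
proof (induction rule: cylindrical.induct)
  case (const c)
  show ?case by (intro exI[of _ "{}"]) (auto intro: cylindrical.intros)
next
  case (coord i \<phi>)
  then show ?case by (intro exI[of _ "{i}"]) (auto intro: cylindrical.intros)
next
  case (add h h')
  then obtain J J' where "finite J" "J \<subseteq> N" "cylindrical J h" "finite J'" "J' \<subseteq> N" "cylindrical J' h'"
    by auto
  then show ?case
    by (intro exI[of _ "J \<union> J'"]) (auto intro!: cylindrical.add elim: cylindrical_mono)
next
  case (mult h h')
  then obtain J J' where "finite J" "J \<subseteq> N" "cylindrical J h" "finite J'" "J' \<subseteq> N" "cylindrical J' h'"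
    by auto
  then show ?case
    by (intro exI[of _ "J \<union> J'"]) (auto intro!: cylindrical.mult elim: cylindrical_mono)
qed

lemma cylindrical_restrict: "cylindrical N h \<Longrightarrow> N \<subseteq> J \<Longrightarrow> h (restrict t J) = h t"
  by (induction rule: cylindrical.induct) auto

lemma continuous_map_cylindrical:
  "cylindrical N h \<Longrightarrow> N \<subseteq> J \<Longrightarrow> continuous_map (powertop_real J) euclideanreal h"
proof (induction rule: cylindrical.induct)
  case (coord i \<phi>)
  then have "continuous_map (powertop_real J) euclideanreal (\<phi> \<circ> (\<lambda>t. t i))"
    by (intro continuous_map_compose[OF continuous_map_product_projection]) auto
  then show ?case by (simp add: o_def)
qed (auto intro: continuous_map_add continuous_map_real_mult)

lemma borel_measurable_cylindrical:
  assumes "cylindrical N h" "\<And>i. i \<in> N \<Longrightarrow> (\<lambda>x. T x i) \<in> borel_measurable M"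
  shows "(\<lambda>x. h (T x)) \<in> borel_measurable M"
  using assms
proof (induction rule: cylindrical.induct)
  case (coord i \<phi>)
  have "\<phi> \<in> borel_measurable borel"
    by (rule borel_measurable_continuous_onI) (rule coord)
  then show ?case using coord by (auto intro: measurable_compose)
qed auto

text \<open>\<open>N\<close> may be uncountable, so the exceptional null sets of all coordinates
  cannot be united. Induction on h combines only finitely many of them.\<close>

lemma cylindrical_AE_cong:
  assumes "cylindrical N h" "\<And>i. i \<in> N \<Longrightarrow> AE x in M. T x i = T' x i"
  shows "AE x in M. h (T x) = h (T' x)"
  using assms
proof (induction rule: cylindrical.induct)
  case (coord i \<phi>)
  from coord(4)[OF coord(1)] show ?case by eventually_elim simp
next
  case (add h h')
  have "AE x in M. h (T x) = h (T' x)" "AE x in M. h' (T x) = h' (T' x)"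
    using add.IH add.prems by simp_all
  then show ?case by eventually_elim simp
next
  case (mult h h')
  have "AE x in M. h (T x) = h (T' x)" "AE x in M. h' (T x) = h' (T' x)"
    using mult.IH mult.prems by simp_all
  then show ?case by eventually_elim simp
qed auto

text \<open>The list is kept as syntax and the value u U of an event is left open, so that one list
  serves two spaces. Events always belong to the limit space; there u is the indicator, while along
  the sequence u U is a continuous function of xi_n replacing it.\<close>

definition lincomb :: "((('i \<Rightarrow> real) \<Rightarrow> real) \<times> 'b set) list \<Rightarrow> ('i \<Rightarrow> real) \<Rightarrow> ('b set \<Rightarrow> real) \<Rightarrow> real" where
  "lincomb ws t u = (\<Sum>(h, U)\<leftarrow>ws. h t * u U)"

definition lincomb_over :: "'i set \<Rightarrow> 'b measure \<Rightarrow> ((('i \<Rightarrow> real) \<Rightarrow> real) \<times> 'b set) list \<Rightarrow> bool" where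
  "lincomb_over N A ws \<longleftrightarrow> (\<forall>(h, U)\<in>set ws. cylindrical N h \<and> U \<in> sets A)"

lemma lincomb_Nil [simp]: "lincomb [] t u = 0"
  and lincomb_Cons [simp]: "lincomb ((h, U) # ws) t u = h t * u U + lincomb ws t u"
  and lincomb_append: "lincomb (ws @ ws') t u = lincomb ws t u + lincomb ws' t u"
  by (auto simp: lincomb_def)

lemma lincomb_over_Nil [simp]: "lincomb_over N A []"
  and lincomb_over_Cons [simp]: "lincomb_over N A ((h, U) # ws) \<longleftrightarrow> cylindrical N h \<and> U \<in> sets A \<and> lincomb_over N A ws"
  and lincomb_over_append [simp]: "lincomb_over N A (ws @ ws') \<longleftrightarrow> lincomb_over N A ws \<and> lincomb_over N A ws'"
  by (auto simp: lincomb_over_def)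

text \<open>The bound is uniform in t and u, so the same constant works in the limit and along the
  whole sequence.\<close>

lemma lincomb_bounded:
  assumes "lincomb_over N A ws"
  shows "\<exists>C\<ge>0. \<forall>t u. (\<forall>U. \<bar>u U\<bar> \<le> D) \<longrightarrow> \<bar>lincomb ws t u\<bar> \<le> C"
  using assms
proof (induction ws)
  case Nil
  show ?case by (intro exI[of _ 0]) auto
next
  case (Cons w ws)
  obtain h U where w: "w = (h, U)" by (cases w)
  obtain C where C: "C \<ge> 0" "\<forall>t u. (\<forall>U. \<bar>u U\<bar> \<le> D) \<longrightarrow> \<bar>lincomb ws t u\<bar> \<le> C"
    using Cons by (auto simp: w)
  obtain K where K: "\<And>t. \<bar>h t\<bar> \<le> K" using cylindrical_bounded[of N h] Cons.prems by (auto simp: w)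
  have "\<bar>lincomb (w # ws) t u\<bar> \<le> K * \<bar>D\<bar> + C" if "\<forall>U. \<bar>u U\<bar> \<le> D" for t and u :: "'b set \<Rightarrow> real"
  proof -
    have "\<bar>h t * u U\<bar> \<le> K * \<bar>D\<bar>"
      unfolding abs_mult using K[of t] that[rule_format, of U]
      by (intro mult_mono) auto
    moreover have "\<bar>lincomb ws t u\<bar> \<le> C" using C(2) that by blast
    ultimately show ?thesis by (simp add: w)
  qed
  moreover have "K \<ge> 0" using K[of undefined] by linarith
  ultimately show ?case using C(1) by (intro exI[of _ "K * \<bar>D\<bar> + C"]) auto
qed

text \<open>Closure under products comes from 1_U 1_V being the indicator of the intersection of U
  and V, which is why the evaluation is fixed to indicators here.\<close>

lemma lincomb_mult:
  assumes "lincomb_over N A ws" "lincomb_over N A ws'"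
  shows "\<exists>vs. lincomb_over N A vs \<and>
    (\<forall>t x. lincomb vs t (\<lambda>U. indicator U x) = lincomb ws t (\<lambda>U. indicator U x) * lincomb ws' t (\<lambda>U. indicator U x))"
proof -
  have single: "\<exists>vs. lincomb_over N A vs \<and>
    (\<forall>t x. lincomb vs t (\<lambda>U. indicator U x) = h t * indicator U x * lincomb ws' t (\<lambda>U. indicator U x))"
    if "cylindrical N h" "U \<in> sets A" for h U
    using assms(2)
  proof (induction ws')
    case Nil
    show ?case by (intro exI[of _ "[]"]) auto
  next
    case (Cons w ws)
    obtain g V where w: "w = (g, V)" by (cases w)
    from Cons obtain vs where "lincomb_over N A vs"
      "\<forall>t x. lincomb vs t (\<lambda>U. indicator U x) = h t * indicator U x * lincomb ws t (\<lambda>U. indicator U x)"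
      by (auto simp: w)
    then show ?case
      using that Cons.prems
      by (intro exI[of _ "(\<lambda>t. h t * g t, U \<inter> V) # vs"])
        (auto simp: w algebra_simps indicator_inter_arith intro: cylindrical.mult)
  qed
  show ?thesis
    using assms(1)
  proof (induction ws)
    case Nil
    show ?case by (intro exI[of _ "[]"]) auto
  next
    case (Cons w ws)
    obtain h U where w: "w = (h, U)" by (cases w)
    from Cons obtain vs where vs: "lincomb_over N A vs"
      "\<forall>t x. lincomb vs t (\<lambda>U. indicator U x) = lincomb ws t (\<lambda>U. indicator U x) * lincomb ws' t (\<lambda>U. indicator U x)"
      by (auto simp: w)
    obtain vs' where vs': "lincomb_over N A vs'"
      "\<forall>t x. lincomb vs' t (\<lambda>U. indicator U x) = h t * indicator U x * lincomb ws' t (\<lambda>U. indicator U x)"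
      using single[of h U] Cons.prems by (auto simp: w)
    show ?case
      using vs vs' by (intro exI[of _ "vs' @ vs"]) (auto simp: w lincomb_append algebra_simps)
  qed
qed

lemma borel_measurable_lincomb:
  assumes "lincomb_over N A ws" "\<And>i. i \<in> N \<Longrightarrow> (\<lambda>x. T x i) \<in> borel_measurable M"
    "\<And>U. U \<in> snd ` set ws \<Longrightarrow> (\<lambda>x. u x U) \<in> borel_measurable M"
  shows "(\<lambda>x. lincomb ws (T x) (u x)) \<in> borel_measurable M"
  using assms
proof (induction ws)
  case (Cons w ws)
  obtain h U where w: "w = (h, U)" by (cases w)
  have "(\<lambda>x. h (T x)) \<in> borel_measurable M"
    by (rule borel_measurable_cylindrical) (use Cons.prems in \<open>auto simp: w\<close>)
  then show ?case
    using Cons by (auto simp: w)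
qed auto

section \<open>The L1 closure of the combinations of cylindrical functions and events\<close>

locale cylinder_approximation = prob_space M
  for M :: "'b measure" and N :: "'i set" and T :: "'b \<Rightarrow> 'i \<Rightarrow> real" and A :: "'b measure" +
  assumes measurable_T: "i \<in> N \<Longrightarrow> (\<lambda>x. T x i) \<in> borel_measurable M"
    and subalgebra_A: "subalgebra M A"
begin

abbreviation comb where "comb ws x \<equiv> lincomb ws (T x) (\<lambda>U. indicator U x)"

text \<open>This is the closure in L1(M) of the algebra spanned by the products h(T) 1_U. It will
  turn out to be all of L1 when T and \<open>A\<close> generate the events up to null sets.\<close>

definition approximable :: "('b \<Rightarrow> real) \<Rightarrow> bool" where
  "approximable X \<longleftrightarrow> integrable M X \<and>
     (\<forall>e>0. \<exists>ws. lincomb_over N A ws \<and> (\<integral>x. \<bar>X x - comb ws x\<bar> \<partial>M) < e)"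

lemma comb_bounded:
  assumes "lincomb_over N A ws"
  obtains C where "C \<ge> 0" "\<And>x. \<bar>comb ws x\<bar> \<le> C"
proof -
  obtain C where "C \<ge> 0" "\<forall>t u. (\<forall>U :: 'b set. \<bar>u U\<bar> \<le> 1) \<longrightarrow> \<bar>lincomb ws t u\<bar> \<le> C"
    using lincomb_bounded[OF assms] by blast
  then show thesis by (intro that[of C]) auto
qed

lemma integrable_comb:
  assumes "lincomb_over N A ws"
  shows "integrable M (comb ws)"
proof -
  obtain C where "\<And>x. \<bar>comb ws x\<bar> \<le> C" using comb_bounded[OF assms] by metis
  moreover have "comb ws \<in> borel_measurable M"
  proof (rule borel_measurable_lincomb[OF assms measurable_T])
    fix U assume "U \<in> snd ` set ws"
    then have "U \<in> sets M" using assms subalgebra_A by (auto simp: lincomb_over_def subalgebra_def)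
    then show "(\<lambda>x. indicator U x :: real) \<in> borel_measurable M" by measurable
  qed
  ultimately show ?thesis by (intro integrable_const_bound[where B = C]) auto
qed

lemma approximable_lincomb:
  assumes "lincomb_over N A ws"
  shows "approximable (comb ws)"
  unfolding approximable_def using integrable_comb[OF assms] assms by (auto intro!: exI[of _ ws])

lemma approximable_limit:
  assumes "integrable M X" "\<And>n. approximable (Y n)" "(\<lambda>n. \<integral>x. \<bar>X x - Y n x\<bar> \<partial>M) \<longlonglongrightarrow> 0"
  shows "approximable X"
  unfolding approximable_def
proof (intro conjI allI impI assms(1))
  fix e :: real assume e: "e > 0"
  then obtain n where n: "(\<integral>x. \<bar>X x - Y n x\<bar> \<partial>M) < e / 2"
    using order_tendstoD(2)[OF assms(3), of "e / 2"] by (auto simp: eventually_sequentially)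
  obtain ws where ws: "lincomb_over N A ws" "(\<integral>x. \<bar>Y n x - comb ws x\<bar> \<partial>M) < e / 2"
    using assms(2)[of n] e unfolding approximable_def by (metis half_gt_zero)
  have iY: "integrable M (Y n)" using assms(2) by (simp add: approximable_def)
  note iW = integrable_comb[OF ws(1)]
  have "(\<integral>x. \<bar>X x - comb ws x\<bar> \<partial>M) \<le> (\<integral>x. \<bar>X x - Y n x\<bar> + \<bar>Y n x - comb ws x\<bar> \<partial>M)"
    using assms(1) iY iW by (intro integral_mono) auto
  also have "\<dots> = (\<integral>x. \<bar>X x - Y n x\<bar> \<partial>M) + (\<integral>x. \<bar>Y n x - comb ws x\<bar> \<partial>M)"
    using assms(1) iY iW by (intro Bochner_Integration.integral_add) auto
  also have "\<dots> < e" using n ws by simp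
  finally show "\<exists>ws. lincomb_over N A ws \<and> (\<integral>x. \<bar>X x - comb ws x\<bar> \<partial>M) < e" using ws by blast
qed

lemma approximable_dominated:
  assumes "X \<in> borel_measurable M" "\<And>n. approximable (Y n)" "integrable M w"
    "AE x in M. (\<lambda>n. Y n x) \<longlonglongrightarrow> X x" "\<And>n. AE x in M. \<bar>Y n x\<bar> \<le> w x"
  shows "approximable X"
proof (rule approximable_limit)
  have mY: "Y n \<in> borel_measurable M" for n using assms(2) by (auto simp: approximable_def)
  show X: "integrable M X"
    by (rule integrable_dominated_convergence[where w = w and s = Y, OF assms(1) mY assms(3,4)])
      (use assms(5) in simp)
  have bX: "AE x in M. \<bar>X x\<bar> \<le> w x"
  proof -
    have "AE x in M. \<forall>n. \<bar>Y n x\<bar> \<le> w x" using assms(5) by (simp add: AE_all_countable)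
    with assms(4) show ?thesis
    proof eventually_elim
      case (elim x)
      show ?case by (rule LIMSEQ_le_const2[OF tendsto_rabs[OF elim(1)]]) (use elim(2) in auto)
    qed
  qed
  have "(\<lambda>n. \<integral>x. \<bar>X x - Y n x\<bar> \<partial>M) \<longlonglongrightarrow> (\<integral>x. 0 \<partial>M)"
  proof (rule integral_dominated_convergence[where w = "\<lambda>x. 2 * w x"])
    show "AE x in M. (\<lambda>n. \<bar>X x - Y n x\<bar>) \<longlonglongrightarrow> 0"
      using assms(4)
    proof eventually_elim
      case (elim x)
      from tendsto_rabs[OF tendsto_diff[OF tendsto_const elim]] show ?case by (metis abs_zero diff_self)
    qed
    show "AE x in M. norm \<bar>X x - Y n x\<bar> \<le> 2 * w x" for n
      using bX assms(5)[of n] by eventually_elim auto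
  qed (use assms(1,3) mY in auto)
  then show "(\<lambda>n. \<integral>x. \<bar>X x - Y n x\<bar> \<partial>M) \<longlonglongrightarrow> 0" by simp
qed (rule assms)

lemma approximable_AE_cong:
  assumes "approximable X" "Y \<in> borel_measurable M" "AE x in M. X x = Y x"
  shows "approximable Y"
proof (rule approximable_dominated[where Y = "\<lambda>n. X" and w = "\<lambda>x. \<bar>X x\<bar>"])
  show "AE x in M. (\<lambda>n. X x) \<longlonglongrightarrow> Y x" using assms(3) by eventually_elim simp
qed (use assms in \<open>auto simp: approximable_def\<close>)

lemma approximable_add:
  assumes "approximable X" "approximable Y"
  shows "approximable (\<lambda>x. X x + Y x)"
  unfolding approximable_def
proof (intro conjI allI impI)
  have iX: "integrable M X" and iY: "integrable M Y" using assms by (auto simp: approximable_def)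
  then show "integrable M (\<lambda>x. X x + Y x)" by auto
  fix e :: real assume e: "e > 0"
  obtain ws where ws: "lincomb_over N A ws" "(\<integral>x. \<bar>X x - comb ws x\<bar> \<partial>M) < e / 2"
    using assms(1) e unfolding approximable_def by (metis half_gt_zero)
  obtain ws' where ws': "lincomb_over N A ws'" "(\<integral>x. \<bar>Y x - comb ws' x\<bar> \<partial>M) < e / 2"
    using assms(2) e unfolding approximable_def by (metis half_gt_zero)
  note i = integrable_comb[OF ws(1)] integrable_comb[OF ws'(1)] iX iY
  have o: "lincomb_over N A (ws @ ws')" using ws ws' by simp
  have "(\<integral>x. \<bar>X x + Y x - comb (ws @ ws') x\<bar> \<partial>M) \<le> (\<integral>x. \<bar>X x - comb ws x\<bar> + \<bar>Y x - comb ws' x\<bar> \<partial>M)"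
    using i integrable_comb[OF o] by (intro integral_mono) (auto simp: lincomb_append)
  also have "\<dots> = (\<integral>x. \<bar>X x - comb ws x\<bar> \<partial>M) + (\<integral>x. \<bar>Y x - comb ws' x\<bar> \<partial>M)"
    using i by (intro Bochner_Integration.integral_add) auto
  also have "\<dots> < e" using ws ws' by simp
  finally show "\<exists>ws. lincomb_over N A ws \<and> (\<integral>x. \<bar>X x + Y x - comb ws x\<bar> \<partial>M) < e" using o by blast
qed

text \<open>Splitting XY - WW' = X (Y - W') + (X - W) W', the first term is handled by the bound 1
  on X and the second by the bound C on W'. Hence W' is chosen first, and W afterwards with an
  accuracy depending on C.\<close>

lemma approximable_mult:
  assumes "approximable X" "approximable Y" "\<And>x. \<bar>X x\<bar> \<le> 1"
  shows "approximable (\<lambda>x. X x * Y x)"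
  unfolding approximable_def
proof (intro conjI allI impI)
  have iX: "integrable M X" and iY: "integrable M Y" using assms by (auto simp: approximable_def)
  have XZ: "integrable M (\<lambda>x. X x * Z x)" if Z: "integrable M Z" for Z :: "'b \<Rightarrow> real"
  proof (rule Bochner_Integration.integrable_bound[OF Z])
    show "AE x in M. norm (X x * Z x) \<le> norm (Z x)"
      using assms(3) by (auto simp: abs_mult intro!: AE_I2 mult_left_le_one_le)
  qed (use iX Z in auto)
  then show "integrable M (\<lambda>x. X x * Y x)" using iY by auto
  fix e :: real assume e: "e > 0"
  obtain ws' where ws': "lincomb_over N A ws'" "(\<integral>x. \<bar>Y x - comb ws' x\<bar> \<partial>M) < e / 2"
    using assms(2) e unfolding approximable_def by (metis half_gt_zero)
  obtain C0 where C0: "C0 \<ge> 0" "\<And>x. \<bar>comb ws' x\<bar> \<le> C0" using comb_bounded[OF ws'(1)] by metis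
  \<comment> \<open>Adding 1 makes the bound strictly positive, so that it can be divided
    by.\<close>
  define C where "C = C0 + 1"
  have C: "C > 0" "\<And>x. \<bar>comb ws' x\<bar> \<le> C"
    using C0(1) by (auto simp: C_def intro: order_trans[OF C0(2)])
  have "e / (2 * C) > 0" using e C by auto
  then obtain ws where ws: "lincomb_over N A ws" "(\<integral>x. \<bar>X x - comb ws x\<bar> \<partial>M) < e / (2 * C)"
    using assms(1) unfolding approximable_def by metis
  obtain vs where vs: "lincomb_over N A vs" "\<And>x. comb vs x = comb ws x * comb ws' x"
    using lincomb_mult[OF ws(1) ws'(1)] by metis
  note i = integrable_comb[OF ws(1)] integrable_comb[OF ws'(1)] iX iY
  have "(\<integral>x. \<bar>X x * Y x - comb vs x\<bar> \<partial>M) \<le> (\<integral>x. \<bar>Y x - comb ws' x\<bar> + C * \<bar>X x - comb ws x\<bar> \<partial>M)"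
  proof (rule integral_mono)
    fix x
    have "X x * Y x - comb vs x = X x * (Y x - comb ws' x) + (X x - comb ws x) * comb ws' x"
      by (simp add: vs algebra_simps)
    also have "\<bar>\<dots>\<bar> \<le> \<bar>X x\<bar> * \<bar>Y x - comb ws' x\<bar> + \<bar>X x - comb ws x\<bar> * \<bar>comb ws' x\<bar>"
      by (metis abs_mult abs_triangle_ineq)
    also have "\<dots> \<le> 1 * \<bar>Y x - comb ws' x\<bar> + \<bar>X x - comb ws x\<bar> * C"
      using assms(3)[of x] C(2)[of x] by (intro add_mono mult_mono) auto
    finally show "\<bar>X x * Y x - comb vs x\<bar> \<le> \<bar>Y x - comb ws' x\<bar> + C * \<bar>X x - comb ws x\<bar>"
      by (simp add: mult.commute)
  qed (use i XZ[OF iY] integrable_comb[OF vs(1)] in auto)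
  also have "\<dots> = (\<integral>x. \<bar>Y x - comb ws' x\<bar> \<partial>M) + C * (\<integral>x. \<bar>X x - comb ws x\<bar> \<partial>M)"
    using i by (subst Bochner_Integration.integral_add) auto
  also have "\<dots> < e"
  proof -
    have "C * (\<integral>x. \<bar>X x - comb ws x\<bar> \<partial>M) < C * (e / (2 * C))"
      using ws(2) C(1) by (intro mult_strict_left_mono) auto
    also have "\<dots> = e / 2" using C(1) by simp
    finally show ?thesis using ws'(2) by simp
  qed
  finally show "\<exists>ws. lincomb_over N A ws \<and> (\<integral>x. \<bar>X x * Y x - comb ws x\<bar> \<partial>M) < e" using vs by blast
qed

lemma approximable_const: "approximable (\<lambda>x. c)"
proof -
  have "space M \<in> sets A" using subalgebra_A by (metis sets.top subalgebra_def)
  then have "lincomb_over N A [(\<lambda>t. c, space M)]" by (auto intro: cylindrical.const)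
  from approximable_lincomb[OF this] show ?thesis
    by (rule approximable_AE_cong) (auto intro!: AE_I2)
qed

text \<open>Products are available only with a factor bounded by 1, so c is written as n (c / n)
  with n at least |c|, and the factor n is realised by repeated addition.\<close>

lemma approximable_cmult:
  assumes "approximable X"
  shows "approximable (\<lambda>x. c * X x)"
proof (cases "c = 0")
  case False
  have 1: "approximable (\<lambda>x. a * X x)" if "\<bar>a\<bar> \<le> 1" for a
    by (rule approximable_mult[OF approximable_const assms]) (use that in auto)
  have 2: "approximable (\<lambda>x. real n * Y x)" if "approximable Y" for n Y
  proof (induction n)
    case (Suc n)
    from approximable_add[OF this that] show ?case by (simp add: algebra_simps)
  qed (simp add: approximable_const)
  obtain n where n: "\<bar>c\<bar> \<le> real n" using real_arch_simple by blast
  with False have "n > 0" by (cases n) auto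
  then have "approximable (\<lambda>x. real n * (c / real n * X x))"
    using n by (intro 2 1) (auto simp: abs_divide)
  then show ?thesis using \<open>n > 0\<close> by simp
qed (simp add: approximable_const)

text \<open>Complements come from 1 - 1_V and intersections from products. Countable unions are
  limits of finite ones by dominated convergence.\<close>

lemma sigma_algebra_approximable:
  "sigma_algebra (space M) {V \<in> sets M. approximable (indicator V)}"
proof -
  let ?D = "{V \<in> sets M. approximable (indicator V)}"
  have compl: "space M - V \<in> ?D" if "V \<in> ?D" for V
  proof -
    have "approximable (\<lambda>x. 1 + (-1) * indicator V x)"
      by (intro approximable_add approximable_const approximable_cmult) (use that in auto)
    then show ?thesis
      using that by (auto elim!: approximable_AE_cong intro!: AE_I2 simp: indicator_def)
  qed
  have int: "V \<inter> V' \<in> ?D" if "V \<in> ?D" "V' \<in> ?D" for V V'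
  proof -
    have "approximable (\<lambda>x. indicator V x * indicator V' x)"
      by (rule approximable_mult) (use that in auto)
    then show ?thesis using that by (auto simp: indicator_inter_arith[abs_def])
  qed
  have empty: "{} \<in> ?D"
  proof -
    have "(indicator {} :: 'b \<Rightarrow> real) = (\<lambda>x. 0)" by (simp add: fun_eq_iff)
    then show ?thesis using approximable_const[of 0] by simp
  qed
  have un: "V \<union> V' \<in> ?D" if "V \<in> ?D" "V' \<in> ?D" for V V'
  proof -
    have "V \<union> V' = space M - ((space M - V) \<inter> (space M - V'))"
      using that sets.sets_into_space by blast
    then show ?thesis using compl[OF int[OF compl compl], OF that] by simp
  qed
  show ?thesis
    unfolding sigma_algebra_iff2
  proof (intro conjI ballI allI impI)
    fix V :: "nat \<Rightarrow> 'b set" assume V: "range V \<subseteq> ?D"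
    have fin: "(\<Union>i<n. V i) \<in> ?D" for n
    proof (induction n)
      case (Suc n)
      have "(\<Union>i<Suc n. V i) = (\<Union>i<n. V i) \<union> V n" by (auto simp: less_Suc_eq)
      moreover have "V n \<in> ?D" using V by blast
      ultimately show ?case using un[OF Suc] by simp
    qed (use empty in simp)
    have m: "(\<Union>i. V i) \<in> sets M" using V by auto
    moreover have "approximable (indicator (\<Union>i. V i))"
    proof (rule approximable_dominated[where Y = "\<lambda>n. indicator (\<Union>i<n. V i)" and w = "\<lambda>x. 1"])
      show "approximable (indicator (\<Union>i<n. V i))" for n using fin[of n] by blast
      show "AE x in M. (\<lambda>n. indicator (\<Union>i<n. V i) x :: real) \<longlonglongrightarrow> indicator (\<Union>i. V i) x"
        by (intro AE_I2 LIMSEQ_indicator_UN)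
      show "AE x in M. \<bar>indicator (\<Union>i<n. V i) x :: real\<bar> \<le> 1" for n
        by (auto simp: indicator_def)
    qed (use m in auto)
    ultimately show "(\<Union>i. V i) \<in> ?D" by blast
  qed (use compl empty sets.sets_into_space in auto)
qed

lemma approximable_indicator_le:
  assumes "i \<in> N"
  shows "approximable (indicator {x \<in> space M. T x i \<le> c})"
proof -
  \<comment> \<open>The function \<open>\<phi> n\<close> is 1 up to c, descends linearly to 0 at c +
    1/n and stays there (for n = 0 it is constantly 1). These bounded continuous functions decrease
    to the indicator of the closed half-line.\<close>
  define \<phi> where "\<phi> n y = max 0 (min 1 (1 - real n * (y - c)))" for n :: nat and y
  have spA: "space M \<in> sets A" using subalgebra_A by (metis sets.top subalgebra_def)
  show ?thesis
  proof (rule approximable_dominated[where Y = "\<lambda>n. comb [(\<lambda>t. \<phi> n (t i), space M)]" and w = "\<lambda>x. 1"])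
    show "approximable (comb [(\<lambda>t. \<phi> n (t i), space M)])" for n
    proof (rule approximable_lincomb)
      have "cylindrical N (\<lambda>t. \<phi> n (t i))"
        by (rule cylindrical.coord[OF assms, where C = 1])
          (auto simp: \<phi>_def[abs_def] intro!: continuous_intros)
      then show "lincomb_over N A [(\<lambda>t. \<phi> n (t i), space M)]" using spA by simp
    qed
    show "AE x in M. \<bar>comb [(\<lambda>t. \<phi> n (t i), space M)] x\<bar> \<le> 1" for n
      by (auto simp: \<phi>_def indicator_def)
    show "AE x in M. (\<lambda>n. comb [(\<lambda>t. \<phi> n (t i), space M)] x) \<longlonglongrightarrow> indicator {x \<in> space M. T x i \<le> c} x"
    proof (rule AE_I2)
      fix x assume x: "x \<in> space M"
      show "(\<lambda>n. comb [(\<lambda>t. \<phi> n (t i), space M)] x) \<longlonglongrightarrow> indicator {x \<in> space M. T x i \<le> c} x"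
      proof (cases "T x i \<le> c")
        case True
        then have "\<phi> n (T x i) = 1" for n
          by (auto simp: \<phi>_def min_def mult_nonneg_nonpos)
        then show ?thesis using x True by simp
      next
        case False
        obtain n0 where n0: "real n0 * (T x i - c) \<ge> 1"
          using False reals_Archimedean3[of "T x i - c"] by (metis diff_gt_0_iff_gt less_imp_le not_le)
        have "\<phi> n (T x i) = 0" if "n \<ge> n0" for n
        proof -
          have "real n0 * (T x i - c) \<le> real n * (T x i - c)"
            using that False by (intro mult_right_mono) auto
          then show ?thesis using n0 by (auto simp: \<phi>_def)
        qed
        then have "\<forall>\<^sub>F n in sequentially. comb [(\<lambda>t. \<phi> n (t i), space M)] x = 0"
          by (auto simp: eventually_sequentially)
        then show ?thesis using False by (simp add: tendsto_eventually)
      qed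
    qed
  qed (use measurable_T[OF assms] in auto)
qed

lemma approximable_indicator_subalgebra:
  assumes "U \<in> sets A"
  shows "approximable (indicator U)"
proof -
  have "lincomb_over N A [(\<lambda>t. 1, U)]" using assms by (auto intro: cylindrical.const)
  from approximable_lincomb[OF this] show ?thesis by simp
qed

lemma approximable_integrable:
  assumes gen: "\<And>V. V \<in> sets M \<Longrightarrow> approximable (indicator V)" and "integrable M X"
  shows "approximable X"
  using assms(2)
proof (induction rule: integrable_induct)
  case (base V c)
  then show ?case using approximable_cmult[OF gen[of V], of c] by (simp add: mult.commute)
next
  case (add f g)
  then show ?case by (intro approximable_add)
next
  case (lim f s)
  show ?case
    by (rule approximable_dominated[where Y = s and w = "\<lambda>x. 2 * \<bar>f x\<bar>"]) (use lim in auto)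
qed

end

text \<open>The other half of the factorisation criterion: the conditional probability computed
  under \<open>Q b\<close> is a version under every \<open>Q j\<close>. Changing measure inserts the
  factor L_j, which is \<open>S\<close>-measurable and so passes through the conditional
  expectation.\<close>

lemma sufficient_if_likelihood_ratios_measurable:
  fixes Q :: "'j \<Rightarrow> 'a measure"
  assumes E: "statistical_experiment B Q" and sub: "subalgebra B S"
    and mL: "\<And>j. likelihood_ratio (Q j) (Q b) \<in> borel_measurable S"
  shows "sufficient B Q S"
proof -
  note mS = measurable_from_subalg[OF sub]
  interpret b: finite_measure_subalgebra "Q b" S
    by (rule finite_measure_subalgebra_experiment[OF E sub])
  show ?thesis
    unfolding sufficient_def
  proof (intro conjI sub ballI)
    fix U assume U: "U \<in> sets B"
    let ?g = "real_cond_exp (Q b) S (indicator U)"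
    let ?L = "\<lambda>j. likelihood_ratio (Q j) (Q b)"
    have gS: "?g \<in> borel_measurable S" by simp
    have mU: "(indicator U :: _ \<Rightarrow> real) \<in> borel_measurable B" using U by simp
    have iU: "integrable (Q j) (indicator U :: _ \<Rightarrow> real)" for j
      by (rule integrable_experiment[OF E mU, where C = 1]) auto
    have iLU: "integrable (Q b) (\<lambda>x. (?L j x * indicator V x) * indicator U x)" if "V \<in> sets S" for j V
    proof -
      have "V \<in> sets B" using that sub by (auto simp: subalgebra_def)
      then have "integrable (Q j) (\<lambda>x. indicator V x * indicator U x :: real)"
        by (intro integrable_experiment[OF E, where C = 1]) (use U in \<open>auto simp: indicator_def\<close>)
      then show ?thesis
        using integrable_likelihood_ratio_iff[OF E, of "\<lambda>x. indicator V x * indicator U x" b j] U \<open>V \<in> sets B\<close>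
        by (auto simp: mult.assoc)
    qed
    show "\<exists>g\<in>borel_measurable S. \<forall>j. AE x in Q j. g x = real_cond_exp (Q j) S (indicator U) x"
    proof (intro bexI[OF _ gS] allI)
      fix j
      interpret j: finite_measure_subalgebra "Q j" S
        by (rule finite_measure_subalgebra_experiment[OF E sub])
      have LV: "(\<lambda>x. ?L j x * indicator V x) \<in> borel_measurable S" if "V \<in> sets S" for V
        using mL that by auto
      have ig: "integrable (Q j) ?g"
      proof -
        \<comment> \<open>Taking the whole space for V lets \<open>iLU\<close> give the
          integrability of L_j times the conditional probability.\<close>
        have "integrable (Q b) (\<lambda>x. (?L j x * indicator (space S) x) * ?g x)"
          by (rule b.real_cond_exp_intg(1)[OF iLU LV])
            (use measurable_experimentI[OF E mU] in auto)
        then have "integrable (Q b) (\<lambda>x. ?L j x * ?g x)"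
          by (rule Bochner_Integration.integrable_cong[THEN iffD1, rotated 2]) (use sub in \<open>auto simp: subalgebra_def statistical_experimentD[OF E]\<close>)
        then show ?thesis using integrable_likelihood_ratio_iff[OF E mS[OF gS]] by blast
      qed
      have "AE x in Q j. real_cond_exp (Q j) S (indicator U) x = ?g x"
      proof (rule j.real_cond_exp_charact)
        fix V assume V: "V \<in> sets S"
        then have VB: "V \<in> sets B" using sub by (auto simp: subalgebra_def)
        have "(\<integral>x. indicator V x * indicator U x \<partial>Q j) = (\<integral>x. ?L j x * (indicator V x * indicator U x) \<partial>Q b)"
          by (rule integral_likelihood_ratio[OF E, symmetric]) (use U VB in auto)
        also have "\<dots> = (\<integral>x. (?L j x * indicator V x) * indicator U x \<partial>Q b)"
          by (simp add: mult.assoc)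
        also have "\<dots> = (\<integral>x. (?L j x * indicator V x) * ?g x \<partial>Q b)"
          by (rule b.real_cond_exp_intg(2)[OF iLU[OF V] LV[OF V], symmetric])
            (rule measurable_experimentI[OF E mU])
        also have "\<dots> = (\<integral>x. ?L j x * (indicator V x * ?g x) \<partial>Q b)"
          by (simp add: mult.assoc)
        also have "\<dots> = (\<integral>x. indicator V x * ?g x \<partial>Q j)"
          by (rule integral_likelihood_ratio[OF E]) (use VB mS[OF gS] in auto)
        finally show "(\<integral>x\<in>V. indicator U x \<partial>Q j) = (\<integral>x\<in>V. ?g x \<partial>Q j)"
          by (simp add: set_lebesgue_integral_def)
      qed (use iU ig gS in auto)
      then show "AE x in Q j. ?g x = real_cond_exp (Q j) S (indicator U) x" by (rule AE_symmetric)
    qed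
  qed
qed

text \<open>This is the sufficient sigma-field against which minimality will be tested. Its
  generators are spelled out as sublevel sets because those are the events shown to be
  approximable.\<close>

lemma sufficient_likelihood_ratios:
  fixes Q :: "'j \<Rightarrow> 'a measure"
  assumes E: "statistical_experiment B Q"
  shows "sufficient B Q (sigma (space B) {{x \<in> space B. likelihood_ratio (Q j) (Q b) x \<le> c} |j c. True})"
    (is "sufficient B Q (sigma _ ?G)")
proof (rule sufficient_if_likelihood_ratios_measurable[OF E])
  have G: "?G \<subseteq> sets B"
    using measurable_likelihood_ratio[OF E] by (auto simp: borel_measurable_iff_le)
  have GP: "?G \<subseteq> Pow (space B)" by blast
  have S: "sets (sigma (space B) ?G) = sigma_sets (space B) ?G" "space (sigma (space B) ?G) = space B"
    using GP by (simp_all add: sets_measure_of space_measure_of)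
  show "subalgebra B (sigma (space B) ?G)"
    unfolding subalgebra_def S using sets.sigma_sets_subset[OF G] by simp
  show "likelihood_ratio (Q j) (Q b) \<in> borel_measurable (sigma (space B) ?G)" for j
    by (rule borel_measurableI_le, unfold S, rule sigma_sets.Basic) blast
qed

text \<open>A nuisance likelihood ratio is \<open>S\<close>-measurable only up to a null set,
  whereas Basu's theorem asks for \<open>S\<close>-measurable variables. Replacing each coordinate
  by an \<open>S\<close>-measurable version changes h(T) on a null set only.\<close>

lemma basu_likelihood_ratios:
  fixes P :: "'i \<Rightarrow> 'a measure" and \<nu> :: "'j \<Rightarrow> 'i" and Z :: "'a \<Rightarrow> real"
  assumes E: "statistical_experiment B P" and b: "b = \<nu> j0"
    and suff: "sufficient B (\<lambda>j. P (\<nu> j)) S" and compl: "boundedly_complete B (\<lambda>j. P (\<nu> j)) S"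
    and anc: "ancillary B (\<lambda>j. P (\<nu> j)) A" and h: "cylindrical (range \<nu>) h"
    and Z: "Z \<in> borel_measurable A" "\<And>x. \<bar>Z x\<bar> \<le> D"
  shows "(\<integral>x. h (\<lambda>i. likelihood_ratio (P i) (P b) x) * Z x \<partial>P b)
    = (\<integral>x. h (\<lambda>i. likelihood_ratio (P i) (P b) x) \<partial>P b) * (\<integral>x. Z x \<partial>P b)"
proof -
  let ?T = "\<lambda>x i. likelihood_ratio (P i) (P b) x"
  note EQ = statistical_experiment_comp[OF E, of \<nu>]
  have subS: "subalgebra B S" using suff by (simp add: sufficient_def)
  have subA: "subalgebra B A" using anc by (simp add: ancillary_def)
  have "\<exists>l. i \<in> range \<nu> \<longrightarrow> l \<in> borel_measurable S \<and> (AE x in P b. ?T x i = l x)" for i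
  proof (cases "i \<in> range \<nu>")
    case True
    then obtain j where j: "i = \<nu> j" by auto
    obtain l where "l \<in> borel_measurable S"
      "AE x in P (\<nu> j0). likelihood_ratio (P (\<nu> j)) (P (\<nu> j0)) x = l x"
      by (rule likelihood_ratio_sufficient_version[OF EQ suff])
    then show ?thesis unfolding b j by blast
  qed auto
  then obtain l where l: "\<And>i. i \<in> range \<nu> \<Longrightarrow> l i \<in> borel_measurable S"
    "\<And>i. i \<in> range \<nu> \<Longrightarrow> AE x in P b. ?T x i = l i x"
    by metis
  obtain C where C: "\<And>t. \<bar>h t\<bar> \<le> C" using cylindrical_bounded[OF h] by auto
  have mT: "(\<lambda>x. h (?T x)) \<in> borel_measurable (P b)"
    by (rule borel_measurable_cylindrical[OF h])
      (rule measurable_experimentI[OF E measurable_likelihood_ratio[OF E]])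
  have mY: "(\<lambda>x. h (\<lambda>i. l i x)) \<in> borel_measurable S"
    by (rule borel_measurable_cylindrical[OF h l(1)])
  note mYb = measurable_experimentI[OF E measurable_from_subalg[OF subS mY], of b]
  note mZb = measurable_experimentI[OF E measurable_from_subalg[OF subA Z(1)], of b]
  have AE: "AE x in P b. h (?T x) = h (\<lambda>i. l i x)"
    by (rule cylindrical_AE_cong[OF h l(2)])
  have "(\<integral>x. h (?T x) * Z x \<partial>P b) = (\<integral>x. h (\<lambda>i. l i x) * Z x \<partial>P b)"
    by (rule integral_cong_AE) (use AE mT mYb mZb in auto)
  also have "\<dots> = (\<integral>x. h (\<lambda>i. l i x) \<partial>P b) * (\<integral>x. Z x \<partial>P b)"
    using basu[OF EQ suff compl anc mY C Z, of j0] b by simp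
  also have "(\<integral>x. h (\<lambda>i. l i x) \<partial>P b) = (\<integral>x. h (?T x) \<partial>P b)"
    by (rule integral_cong_AE) (use AE mT mYb in auto)
  finally show ?thesis .
qed

section \<open>Density in L1 of the combinations built on nuisance likelihood ratios\<close>

lemma cylinder_approximation_experiment:
  assumes "statistical_experiment B P" "subalgebra B A"
  shows "cylinder_approximation (P b) N (\<lambda>x i. likelihood_ratio (P i) (P b) x) A"
proof -
  interpret prob_space "P b" by (rule statistical_experimentD[OF assms(1)])
  show ?thesis
    by unfold_locales
      (rule measurable_experimentI[OF assms(1) measurable_likelihood_ratio[OF assms(1)]]
        subalgebra_experiment[OF assms])+
qed

text \<open>The approximable events form a sigma-field that is insensitive to null modifications. It
  contains the sublevel sets of the nuisance likelihood ratios, therefore \<open>S\<close> by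
  minimality, and also \<open>A\<close>; so it is all of \<open>B\<close>, and integrable functions
  follow from events.\<close>

lemma approximable_integrable_experiment:
  fixes P :: "'i \<Rightarrow> 'a measure" and \<nu> :: "'j \<Rightarrow> 'i"
  assumes E: "statistical_experiment B P" and b: "b = \<nu> j0"
    and min: "minimal_sufficient B (\<lambda>j. P (\<nu> j)) S"
    and A: "subalgebra B A" and gen: "jointly_generate B S A"
    and X: "integrable (P b) X"
  shows "cylinder_approximation.approximable (P b) (range \<nu>) (\<lambda>x i. likelihood_ratio (P i) (P b) x) A X"
proof -
  note D = statistical_experimentD[OF E]
  note EQ = statistical_experiment_comp[OF E, of \<nu>]
  interpret cylinder_approximation "P b" "range \<nu>" "\<lambda>x i. likelihood_ratio (P i) (P b) x" A
    by (rule cylinder_approximation_experiment[OF E A])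
  let ?D = "{V \<in> sets (P b). approximable (indicator V)}"
  interpret D: sigma_algebra "space (P b)" ?D by (rule sigma_algebra_approximable)
  define R where "R = sigma (space B) {{x \<in> space B. likelihood_ratio (P (\<nu> j)) (P (\<nu> j0)) x \<le> c} |j c. True}"
  have subS: "subalgebra B S" using min by (auto simp: minimal_sufficient_def sufficient_def)
  have "sufficient B (\<lambda>j. P (\<nu> j)) R"
    unfolding R_def by (rule sufficient_likelihood_ratios[OF EQ])
  then have SR: "subset_mod_null B (\<lambda>j. P (\<nu> j)) S R"
    using min by (simp add: minimal_sufficient_def)
  have "{{x \<in> space B. likelihood_ratio (P (\<nu> j)) (P (\<nu> j0)) x \<le> c} |j c. True} \<subseteq> ?D"
  proof safe
    fix j c
    have "approximable (indicator {x \<in> space (P b). likelihood_ratio (P (\<nu> j)) (P b) x \<le> c})"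
      by (rule approximable_indicator_le) simp
    then show "approximable (indicator {x \<in> space B. likelihood_ratio (P (\<nu> j)) (P (\<nu> j0)) x \<le> c})"
      using D b by simp
    show "{x \<in> space B. likelihood_ratio (P (\<nu> j)) (P (\<nu> j0)) x \<le> c} \<in> events"
      using measurable_likelihood_ratio[OF E, of "\<nu> j" "\<nu> j0"] D by (auto simp: borel_measurable_iff_le)
  qed
  then have "sigma_sets (space (P b)) {{x \<in> space B. likelihood_ratio (P (\<nu> j)) (P (\<nu> j0)) x \<le> c} |j c. True} \<subseteq> ?D"
    by (rule D.sigma_sets_subset)
  then have RD: "sets R \<subseteq> ?D"
    using D by (auto simp: R_def sets_measure_of_conv)
  have SD: "sets S \<subseteq> ?D"
  proof
    fix U assume U: "U \<in> sets S"
    then have UB: "U \<in> sets (P b)" using subS D by (auto simp: subalgebra_def)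
    obtain V where V: "V \<in> sets R" "sym_diff U V \<in> family_null_sets B (\<lambda>j. P (\<nu> j))"
      using SR U by (auto simp: subset_mod_null_def)
    \<comment> \<open>A null set of the nuisance family is null for \<open>P b\<close> because b =
      \<open>\<nu> j0\<close> is one of its indices.\<close>
    then have "sym_diff U V \<in> null_sets (P b)"
      using D b by (auto simp: family_null_sets_def)
    then have "AE x in P b. x \<notin> sym_diff U V" by (rule AE_not_in)
    then have AE: "AE x in P b. indicator V x = (indicator U x :: real)"
      by eventually_elim (auto simp: indicator_def)
    have "approximable (indicator U)"
      by (rule approximable_AE_cong[OF _ _ AE]) (use RD V UB in auto)
    with UB show "U \<in> ?D" by blast
  qed
  have AD: "sets A \<subseteq> ?D"
    using approximable_indicator_subalgebra A D by (auto simp: subalgebra_def)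
  have "sigma_sets (space (P b)) (sets S \<union> sets A) \<subseteq> ?D"
    by (rule D.sigma_sets_subset) (use SD AD in blast)
  then have "sets (P b) \<subseteq> ?D"
    using gen D by (simp add: jointly_generate_def)
  then have "approximable (indicator V)" if "V \<in> events" for V
    using that by auto
  then show ?thesis
    by (rule approximable_integrable[OF _ X])
qed

subsection \<open>Weak convergence from Lipschitz test functions\<close>

lemma exists_rational_near:
  fixes t :: "'i \<Rightarrow> real"
  assumes "finite J" "0 < e"
  shows "\<exists>q\<in>PiE J (\<lambda>_. \<rat>). (\<Sum>i\<in>J. \<bar>t i - q i\<bar>) < e"
proof -
  \<comment> \<open>The added 1 admits an empty J and makes the final inequality strict.\<close>
  define d where "d = e / (real (card J) + 1)"
  have d: "d > 0" using assms by (simp add: d_def)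
  have "\<exists>r\<in>\<rat>. \<bar>t i - r\<bar> < d" for i
    using Rats_dense_in_real[of "t i" "t i + d"] d by force
  then obtain r where r: "\<And>i. r i \<in> \<rat>" "\<And>i. \<bar>t i - r i\<bar> < d" by metis
  have "(\<Sum>i\<in>J. \<bar>t i - restrict r J i\<bar>) \<le> (\<Sum>i\<in>J. d)"
    using r(2) by (intro sum_mono) (auto intro: less_imp_le)
  also have "\<dots> = real (card J) * d" by simp
  also have "\<dots> < (real (card J) + 1) * d" using d by (simp add: distrib_right)
  also have "\<dots> = e" by (simp add: d_def)
  finally show ?thesis using r(1) by (intro bexI[of _ "restrict r J"]) auto
qed

text \<open>A basic open box around t contains an l1 ball, whose radius is the least of the
  coordinate radii since J is finite.\<close>

lemma continuous_map_powertop_real_eps_delta: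
  assumes J: "finite J" and f: "continuous_map (powertop_real J) euclideanreal f"
    and t: "t \<in> extensional J" and e: "0 < e"
  shows "\<exists>d>0. \<forall>s\<in>extensional J. (\<Sum>i\<in>J. \<bar>t i - s i\<bar>) < d \<longrightarrow> \<bar>f s - f t\<bar> < e"
proof -
  let ?W = "{s \<in> topspace (powertop_real J). f s \<in> ball (f t) e}"
  have W: "openin (powertop_real J) ?W"
    by (rule openin_continuous_map_preimage[OF f]) auto
  have "t \<in> ?W" using t e by (auto simp: PiE_def)
  from bspec[OF openin_product_topology_alt[THEN iffD1, OF W] this] obtain U where U: "\<forall>i\<in>J. openin euclidean (U i)" "t \<in> Pi\<^sub>E J U" "Pi\<^sub>E J U \<subseteq> ?W"
    by (elim exE conjE) (rule that)
  have "\<exists>d>0. \<forall>y. \<bar>t i - y\<bar> < d \<longrightarrow> y \<in> U i" if "i \<in> J" for i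
  proof -
    have "t i \<in> U i" using U(2) that by auto
    moreover have "open (U i)" using U(1) that by simp
    ultimately obtain d where "d > 0" "ball (t i) d \<subseteq> U i" by (auto simp: open_contains_ball)
    then show ?thesis by (intro exI[of _ d]) (auto simp: dist_real_def subset_eq)
  qed
  then obtain d where d: "\<And>i. i \<in> J \<Longrightarrow> d i > 0" "\<And>i y. i \<in> J \<Longrightarrow> \<bar>t i - y\<bar> < d i \<Longrightarrow> y \<in> U i"
    by metis
  \<comment> \<open>Inserting 1 keeps the minimum meaningful and positive when J is empty.\<close>
  define D where "D = Min (insert 1 (d ` J))"
  have D: "D > 0" "\<And>i. i \<in> J \<Longrightarrow> D \<le> d i" using J d(1) by (auto simp: D_def)
  show ?thesis
  proof (intro exI[of _ D] conjI ballI impI D(1))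
    fix s assume s: "s \<in> extensional J" and less: "(\<Sum>i\<in>J. \<bar>t i - s i\<bar>) < D"
    have "s i \<in> U i" if "i \<in> J" for i
    proof (rule d(2)[OF that])
      have "\<bar>t i - s i\<bar> \<le> (\<Sum>i\<in>J. \<bar>t i - s i\<bar>)" by (rule member_le_sum) (use that J in auto)
      then show "\<bar>t i - s i\<bar> < d i" using less D(2)[OF that] by linarith
    qed
    then have "s \<in> Pi\<^sub>E J U" using s by (auto simp: PiE_def)
    then have "f s \<in> ball (f t) e" using U(3) by blast
    then show "\<bar>f s - f t\<bar> < e" by (simp add: dist_real_def abs_minus_commute)
  qed
qed

text \<open>The Pasch-Hausdorff envelope of f for the l1 distance, a Lipschitz minorant with
  constant k when f is bounded and continuous. The infimum runs over rational points: countability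
  gives measurability, and density loses nothing for continuous f. Bounds and Lipschitz estimates
  hold at every t, even where f itself is uncontrolled because t is not extensional.\<close>

definition inf_convolution :: "'i set \<Rightarrow> (('i \<Rightarrow> real) \<Rightarrow> real) \<Rightarrow> real \<Rightarrow> ('i \<Rightarrow> real) \<Rightarrow> real" where
  "inf_convolution J f k t = (INF q\<in>PiE J (\<lambda>_. \<rat>). f q + k * (\<Sum>i\<in>J. \<bar>t i - q i\<bar>))"

context
  fixes J :: "'i set" and f :: "('i \<Rightarrow> real) \<Rightarrow> real" and C :: real
  assumes J: "finite J" and f: "continuous_map (powertop_real J) euclideanreal f"
    and C: "\<And>t. t \<in> extensional J \<Longrightarrow> \<bar>f t\<bar> \<le> C"
begin

abbreviation grid :: "('i \<Rightarrow> real) set" where "grid \<equiv> PiE J (\<lambda>_. \<rat>)"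

lemma grid_nonempty: "grid \<noteq> {}"
  by (auto simp: PiE_eq_empty_iff)

lemma grid_extensional: "q \<in> grid \<Longrightarrow> q \<in> extensional J"
  by (simp add: PiE_def)

lemma inf_convolution_lower:
  assumes "k \<ge> 0" "q \<in> grid"
  shows "- C \<le> f q + k * (\<Sum>i\<in>J. \<bar>t i - q i\<bar>)"
proof -
  have "- C \<le> f q" using C[OF grid_extensional[OF assms(2)]] by linarith
  moreover have "0 \<le> k * (\<Sum>i\<in>J. \<bar>t i - q i\<bar>)" using assms by (intro mult_nonneg_nonneg sum_nonneg) auto
  ultimately show ?thesis by linarith
qed

lemma bdd_below_inf_convolution:
  assumes "k \<ge> 0"
  shows "bdd_below ((\<lambda>q. f q + k * (\<Sum>i\<in>J. \<bar>t i - q i\<bar>)) ` grid)"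
  by (rule bdd_belowI2[where m = "- C"]) (rule inf_convolution_lower[OF assms])

lemma inf_convolution_le:
  assumes "k \<ge> 0" "q \<in> grid"
  shows "inf_convolution J f k t \<le> f q + k * (\<Sum>i\<in>J. \<bar>t i - q i\<bar>)"
  unfolding inf_convolution_def by (rule cINF_lower[OF bdd_below_inf_convolution]) (rule assms)+

lemma inf_convolution_bounded:
  assumes k: "k \<ge> 0"
  shows "\<bar>inf_convolution J f k t\<bar> \<le> C"
proof -
  have "- C \<le> inf_convolution J f k t"
    unfolding inf_convolution_def
    by (rule cINF_greatest[OF grid_nonempty]) (rule inf_convolution_lower[OF k])
  moreover have "inf_convolution J f k t \<le> C"
  proof (rule field_le_epsilon)
    fix e :: real assume e: "0 < e"
    \<comment> \<open>Since t need not be a grid point, the upper bound is taken at a nearby one.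
      The divisor k + 1 keeps the penalty below e and remains positive for k = 0.\<close>
    then have "0 < e / (k + 1)" using k by simp
    from exists_rational_near[OF J this, of t] obtain q where
      q: "q \<in> grid" "(\<Sum>i\<in>J. \<bar>t i - q i\<bar>) < e / (k + 1)" by blast
    have "k * (\<Sum>i\<in>J. \<bar>t i - q i\<bar>) \<le> k * (e / (k + 1))"
      using q(2) k by (intro mult_left_mono) auto
    also have "\<dots> \<le> e" using k e by (simp add: field_simps)
    finally show "inf_convolution J f k t \<le> C + e"
      using inf_convolution_le[OF k q(1), of t] C[OF grid_extensional[OF q(1)]] by linarith
  qed
  ultimately show ?thesis by (simp add: abs_le_iff)
qed

lemma inf_convolution_lipschitz:
  assumes k: "k \<ge> 0"
  shows "\<bar>inf_convolution J f k s - inf_convolution J f k t\<bar> \<le> k * (\<Sum>i\<in>J. \<bar>s i - t i\<bar>)"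
proof -
  have *: "inf_convolution J f k s - k * (\<Sum>i\<in>J. \<bar>s i - t i\<bar>) \<le> inf_convolution J f k t" for s t
    unfolding inf_convolution_def[of J f k t]
  proof (rule cINF_greatest[OF grid_nonempty])
    fix q assume q: "q \<in> grid"
    have "(\<Sum>i\<in>J. \<bar>s i - q i\<bar>) \<le> (\<Sum>i\<in>J. \<bar>s i - t i\<bar>) + (\<Sum>i\<in>J. \<bar>t i - q i\<bar>)"
      unfolding sum.distrib[symmetric] by (intro sum_mono) linarith
    then have "k * (\<Sum>i\<in>J. \<bar>s i - q i\<bar>) \<le> k * ((\<Sum>i\<in>J. \<bar>s i - t i\<bar>) + (\<Sum>i\<in>J. \<bar>t i - q i\<bar>))"
      using k by (rule mult_left_mono)
    then show "inf_convolution J f k s - k * (\<Sum>i\<in>J. \<bar>s i - t i\<bar>) \<le> f q + k * (\<Sum>i\<in>J. \<bar>t i - q i\<bar>)"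
      using inf_convolution_le[OF k q, of s] by (simp add: distrib_left)
  qed
  have "(\<Sum>i\<in>J. \<bar>t i - s i\<bar>) = (\<Sum>i\<in>J. \<bar>s i - t i\<bar>)" by (simp add: abs_minus_commute)
  then show ?thesis using *[of s t] *[of t s] by (simp add: abs_le_iff)
qed

text \<open>For irrational t the choice q = t is not admissible. A nearby grid point costs at most
  e/2 through the continuity of f and at most e/2 through the penalty.\<close>

lemma inf_convolution_le_self:
  assumes k: "k \<ge> 0" and t: "t \<in> extensional J"
  shows "inf_convolution J f k t \<le> f t"
proof (rule field_le_epsilon)
  fix e :: real assume e: "0 < e"
  then have e2: "0 < e / 2" by simp
  obtain d where d: "d > 0" "\<forall>s\<in>extensional J. (\<Sum>i\<in>J. \<bar>t i - s i\<bar>) < d \<longrightarrow> \<bar>f s - f t\<bar> < e / 2"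
    using continuous_map_powertop_real_eps_delta[OF J f t e2] by blast
  have "0 < min d (e / (2 * (k + 1)))" using k d e by simp
  from exists_rational_near[OF J this, of t] obtain q where
    q: "q \<in> grid" "(\<Sum>i\<in>J. \<bar>t i - q i\<bar>) < min d (e / (2 * (k + 1)))" by blast
  have "k * (\<Sum>i\<in>J. \<bar>t i - q i\<bar>) \<le> k * (e / (2 * (k + 1)))"
    using q(2) k by (intro mult_left_mono) auto
  also have "\<dots> \<le> e / 2" using k e by (simp add: field_simps)
  finally have "k * (\<Sum>i\<in>J. \<bar>t i - q i\<bar>) \<le> e / 2" .
  moreover have "\<bar>f q - f t\<bar> < e / 2" using d(2) q grid_extensional[OF q(1)] by auto
  ultimately show "inf_convolution J f k t \<le> f t + e"
    using inf_convolution_le[OF k q(1), of t] by linarith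
qed

lemma inf_convolution_tendsto:
  assumes t: "t \<in> extensional J"
  shows "(\<lambda>k. inf_convolution J f (real k) t) \<longlonglongrightarrow> f t"
proof (rule LIMSEQ_I)
  fix e :: real assume e: "0 < e"
  then have e2: "0 < e / 2" by simp
  obtain d where d: "d > 0" "\<forall>s\<in>extensional J. (\<Sum>i\<in>J. \<bar>t i - s i\<bar>) < d \<longrightarrow> \<bar>f s - f t\<bar> < e / 2"
    using continuous_map_powertop_real_eps_delta[OF J f t e2] by blast
  \<comment> \<open>At l1 distance d or more from t the penalty is then at least 2C, which outweighs
    the largest possible drop of f from t to q.\<close>
  obtain k0 where k0: "2 * C / d \<le> real k0" using real_arch_simple by blast
  have "f t - e / 2 \<le> inf_convolution J f (real k) t" if "k \<ge> k0" for k
    unfolding inf_convolution_def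
  proof (rule cINF_greatest[OF grid_nonempty])
    fix q assume q: "q \<in> grid"
    show "f t - e / 2 \<le> f q + real k * (\<Sum>i\<in>J. \<bar>t i - q i\<bar>)"
    proof (cases "(\<Sum>i\<in>J. \<bar>t i - q i\<bar>) < d")
      case True
      then have "\<bar>f q - f t\<bar> < e / 2" using d(2) grid_extensional[OF q] by auto
      moreover have "0 \<le> real k * (\<Sum>i\<in>J. \<bar>t i - q i\<bar>)" by (intro mult_nonneg_nonneg sum_nonneg) auto
      ultimately show ?thesis by linarith
    next
      case False
      have "2 * C \<le> real k0 * d" using k0 d(1) by (simp add: field_simps)
      also have "\<dots> \<le> real k * (\<Sum>i\<in>J. \<bar>t i - q i\<bar>)"
        using that False d(1) by (intro mult_mono) auto
      finally show ?thesis using C[OF t] C[OF grid_extensional[OF q]] e by linarith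
    qed
  qed
  then have "norm (inf_convolution J f (real k) t - f t) < e" if "k \<ge> k0" for k
    using that[THEN \<open>\<And>k. k0 \<le> k \<Longrightarrow> _ \<le> inf_convolution J f (real k) t\<close>]
      inf_convolution_le_self[OF _ t, of "real k"] e by auto
  then show "\<exists>no. \<forall>n\<ge>no. norm (inf_convolution J f (real n) t - f t) < e" by blast
qed

lemma borel_measurable_inf_convolution:
  assumes "k \<ge> 0"
  shows "inf_convolution J f k \<in> borel_measurable (PiM J (\<lambda>_. borel))"
  unfolding inf_convolution_def[abs_def]
proof (rule borel_measurable_cINF_real)
  show "countable grid" by (intro countable_PiE J) (simp add: countable_rat)
  show "(\<lambda>t. f q + k * (\<Sum>i\<in>J. \<bar>t i - q i\<bar>)) \<in> borel_measurable (PiM J (\<lambda>_. borel))" for q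
    by measurable
qed

text \<open>As a pointwise limit of its envelopes, f is measurable for the product sigma-field; no
  comparison of that sigma-field with the Borel sets of the product topology enters.\<close>

lemma borel_measurable_of_inf_convolution: "f \<in> borel_measurable (PiM J (\<lambda>_. borel))"
proof (rule borel_measurable_LIMSEQ_real)
  fix t :: "'i \<Rightarrow> real" assume "t \<in> space (PiM J (\<lambda>_. borel))"
  then have "t \<in> extensional J" by (simp add: space_PiM PiE_def)
  then show "(\<lambda>k. inf_convolution J f (real k) t) \<longlonglongrightarrow> f t" by (rule inf_convolution_tendsto)
qed (rule borel_measurable_inf_convolution, simp)

text \<open>The envelopes lie below f and converge to it: one of them nearly attains the limiting
  integral, the Lipschitz hypothesis carries it along the sequence, and f dominates it there. Hence
  the estimate is one-sided.\<close>

lemma integral_liminf_of_lipschitz: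
  fixes Mn :: "nat \<Rightarrow> 'a measure" and M :: "'b measure"
  assumes Mn: "\<And>n. prob_space (Mn n)" and M: "prob_space M"
    and Xn: "\<And>n. Xn n \<in> measurable (Mn n) (PiM J (\<lambda>_. borel))"
    and X: "X \<in> measurable M (PiM J (\<lambda>_. borel))"
    and lip: "\<And>F k C. F \<in> borel_measurable (PiM J (\<lambda>_. borel)) \<Longrightarrow> (\<And>t. \<bar>F t\<bar> \<le> C) \<Longrightarrow>
      (\<And>s t. \<bar>F s - F t\<bar> \<le> k * (\<Sum>i\<in>J. \<bar>s i - t i\<bar>)) \<Longrightarrow> 0 \<le> k \<Longrightarrow>
      (\<lambda>n. \<integral>x. F (Xn n x) \<partial>Mn n) \<longlonglongrightarrow> (\<integral>x. F (X x) \<partial>M)"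
    and e: "0 < e"
  shows "\<forall>\<^sub>F n in sequentially. (\<integral>x. f (X x) \<partial>M) - e < (\<integral>x. f (Xn n x) \<partial>Mn n)"
proof -
  interpret M: prob_space M by (rule M)
  have ext: "X x \<in> extensional J" if "x \<in> space M" for x
    using measurable_space[OF X that] by (simp add: space_PiM PiE_def)
  have extn: "Xn n x \<in> extensional J" if "x \<in> space (Mn n)" for n x
    using measurable_space[OF Xn that] by (simp add: space_PiM PiE_def)
  have mk: "(\<lambda>x. inf_convolution J f (real k) (X x)) \<in> borel_measurable M" for k
    by (rule measurable_compose[OF X borel_measurable_inf_convolution]) simp
  have mf: "(\<lambda>x. f (X x)) \<in> borel_measurable M"
    by (rule measurable_compose[OF X borel_measurable_of_inf_convolution])
  have "(\<lambda>k. \<integral>x. inf_convolution J f (real k) (X x) \<partial>M) \<longlonglongrightarrow> (\<integral>x. f (X x) \<partial>M)"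
    by (rule integral_dominated_convergence[where w = "\<lambda>_. C"])
      (use mk mf inf_convolution_tendsto ext inf_convolution_bounded in auto)
  then have "\<forall>\<^sub>F k in sequentially. (\<integral>x. f (X x) \<partial>M) - e < (\<integral>x. inf_convolution J f (real k) (X x) \<partial>M)"
    by (rule order_tendstoD(1)) (use e in simp)
  then obtain k where k: "(\<integral>x. f (X x) \<partial>M) - e < (\<integral>x. inf_convolution J f (real k) (X x) \<partial>M)"
    by (auto simp: eventually_sequentially)
  have "(\<lambda>n. \<integral>x. inf_convolution J f (real k) (Xn n x) \<partial>Mn n)
      \<longlonglongrightarrow> (\<integral>x. inf_convolution J f (real k) (X x) \<partial>M)"
    by (rule lip[OF borel_measurable_inf_convolution inf_convolution_bounded inf_convolution_lipschitz]) simp_all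
  then have "\<forall>\<^sub>F n in sequentially. (\<integral>x. f (X x) \<partial>M) - e < (\<integral>x. inf_convolution J f (real k) (Xn n x) \<partial>Mn n)"
    using k by (rule order_tendstoD(1))
  then show ?thesis
  proof eventually_elim
    case (elim n)
    interpret n: prob_space "Mn n" by (rule Mn)
    have "(\<integral>x. inf_convolution J f (real k) (Xn n x) \<partial>Mn n) \<le> (\<integral>x. f (Xn n x) \<partial>Mn n)"
    proof (rule integral_mono)
      show "integrable (Mn n) (\<lambda>x. inf_convolution J f (real k) (Xn n x))"
        by (rule n.integrable_const_bound[where B = C])
          (use inf_convolution_bounded measurable_compose[OF Xn borel_measurable_inf_convolution] in auto)
      show "integrable (Mn n) (\<lambda>x. f (Xn n x))"
        by (rule n.integrable_const_bound[where B = C])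
          (use C extn measurable_compose[OF Xn borel_measurable_of_inf_convolution] in auto)
    qed (use extn inf_convolution_le_self in auto)
    with elim show ?case by linarith
  qed
qed

end

text \<open>The one-sided estimate is applied to f and to - f, whose lower bound is the missing
  upper bound for f.\<close>

lemma conv_in_distribution_lipschitzI:
  fixes Mn :: "nat \<Rightarrow> 'a measure" and M :: "'b measure" and J :: "'i set"
  assumes J: "finite J" and Mn: "\<And>n. prob_space (Mn n)" and M: "prob_space M"
    and Xn: "\<And>n. Xn n \<in> measurable (Mn n) (PiM J (\<lambda>_. borel))"
    and X: "X \<in> measurable M (PiM J (\<lambda>_. borel))"
    and lip: "\<And>F k C. F \<in> borel_measurable (PiM J (\<lambda>_. borel)) \<Longrightarrow> (\<And>t. \<bar>F t\<bar> \<le> C) \<Longrightarrow>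
      (\<And>s t. \<bar>F s - F t\<bar> \<le> k * (\<Sum>i\<in>J. \<bar>s i - t i\<bar>)) \<Longrightarrow> 0 \<le> k \<Longrightarrow>
      (\<lambda>n. \<integral>x. F (Xn n x) \<partial>Mn n) \<longlonglongrightarrow> (\<integral>x. F (X x) \<partial>M)"
  shows "conv_in_distribution (powertop_real J) Mn Xn M X"
  unfolding conv_in_distribution_def
proof (intro allI impI, elim conjE)
  fix f assume f: "continuous_map (powertop_real J) euclideanreal f"
    and bd: "bounded (f ` topspace (powertop_real J))"
  obtain C where C: "\<And>t. t \<in> extensional J \<Longrightarrow> \<bar>f t\<bar> \<le> C"
    using bd by (auto simp: bounded_iff PiE_def)
  have f': "continuous_map (powertop_real J) euclideanreal (\<lambda>t. - f t)"
    using f by (rule continuous_map_minus)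
  have C': "\<And>t. t \<in> extensional J \<Longrightarrow> \<bar>- f t\<bar> \<le> C" using C by simp
  show "(\<lambda>n. \<integral>x. f (Xn n x) \<partial>Mn n) \<longlonglongrightarrow> (\<integral>x. f (X x) \<partial>M)"
  proof (rule tendstoI)
    fix e :: real assume e: "0 < e"
    have "\<forall>\<^sub>F n in sequentially. (\<integral>x. f (X x) \<partial>M) - e < (\<integral>x. f (Xn n x) \<partial>Mn n)"
      by (rule integral_liminf_of_lipschitz[OF J f C Mn M Xn X lip e])
    moreover have "\<forall>\<^sub>F n in sequentially. (\<integral>x. - f (X x) \<partial>M) - e < (\<integral>x. - f (Xn n x) \<partial>Mn n)"
      by (rule integral_liminf_of_lipschitz[OF J f' C' Mn M Xn X lip e])
    ultimately show "\<forall>\<^sub>F n in sequentially. dist (\<integral>x. f (Xn n x) \<partial>Mn n) (\<integral>x. f (X x) \<partial>M) < e"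
      by eventually_elim (simp add: dist_real_def abs_less_iff)
  qed
qed

subsection \<open>Convergence of the restricted experiments\<close>

text \<open>One integer-valued random variable encodes finitely many events, and continuous functions of
  it decode them: convergence of \<open>\<sigma>\<close>-fields only provides one random variable at a time.\<close>

lemma encode_events:
  assumes "finite \<U>" "\<U> \<subseteq> sets A"
  obtains \<xi> :: "'b \<Rightarrow> real" and \<phi> :: "'b set \<Rightarrow> real \<Rightarrow> real" and D where
    "\<xi> \<in> borel_measurable A" "\<And>U. continuous_on UNIV (\<phi> U)" "\<And>U y. \<bar>\<phi> U y\<bar> \<le> D"
    "\<And>U x. U \<in> \<U> \<Longrightarrow> \<phi> U (\<xi> x) = indicator U x"
proof -
  obtain c :: "'b set \<Rightarrow> nat" where c: "inj_on c \<U>"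
    using finite_imp_inj_to_nat_seg[OF assms(1)] by blast
  define e where "e X = set_encode (c ` X)" for X
  have e: "e X = e Y \<longleftrightarrow> X = Y" if "X \<subseteq> \<U>" "Y \<subseteq> \<U>" for X Y
  proof -
    have "finite X" "finite Y" using that assms(1) by (auto intro: finite_subset)
    then show ?thesis
      unfolding e_def using inj_on_image_eq_iff[OF c that] set_encode_eq[of "c ` X" "c ` Y"] by simp
  qed
  \<comment> \<open>The value at x is the binary code of the subfamily of events containing
    x.\<close>
  define \<xi> where "\<xi> x = (\<Sum>U\<in>\<U>. 2 ^ c U * indicator U x :: real)" for x
  \<comment> \<open>A sum of tents of height 1 and half-width 1, centred at the codes of the
    subfamilies containing U. Codes are distinct integers, so at a code every tent centred elsewhere
    vanishes.\<close>
  define \<phi> where "\<phi> U y = (\<Sum>X\<in>Pow \<U>. of_bool (U \<in> X) * max 0 (1 - \<bar>y - real (e X)\<bar>))" for U y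
  have \<xi>: "\<xi> x = real (e {U \<in> \<U>. x \<in> U})" for x
  proof -
    have "real (e {U \<in> \<U>. x \<in> U}) = (\<Sum>U\<in>{U \<in> \<U>. x \<in> U}. 2 ^ c U)"
      unfolding e_def set_encode_def
      using c by (subst sum.reindex) (auto intro: inj_on_subset)
    also have "\<dots> = \<xi> x"
      unfolding \<xi>_def using assms(1) by (intro sum.mono_neutral_cong_left) (auto simp: indicator_def)
    finally show ?thesis by simp
  qed
  show thesis
  proof (rule that[of \<xi> \<phi> "real (card (Pow \<U>))"])
    show "\<xi> \<in> borel_measurable A"
      unfolding \<xi>_def[abs_def] using assms by (intro borel_measurable_sum) auto
    show "continuous_on UNIV (\<phi> U)" for U
      unfolding \<phi>_def[abs_def] by (intro continuous_intros)
    show "\<bar>\<phi> U y\<bar> \<le> real (card (Pow \<U>))" for U y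
    proof -
      have "\<bar>\<phi> U y\<bar> \<le> (\<Sum>X\<in>Pow \<U>. \<bar>of_bool (U \<in> X) * max 0 (1 - \<bar>y - real (e X)\<bar>)\<bar>)"
        unfolding \<phi>_def by (rule sum_abs)
      also have "\<dots> \<le> (\<Sum>X\<in>Pow \<U>. 1)" by (intro sum_mono) auto
      finally show ?thesis by simp
    qed
    fix U x assume U: "U \<in> \<U>"
    let ?X = "{U \<in> \<U>. x \<in> U}"
    have "\<phi> U (\<xi> x) = (\<Sum>X\<in>Pow \<U>. if X = ?X then of_bool (U \<in> X) else 0)"
      unfolding \<phi>_def \<xi>
    proof (intro sum.cong refl)
      fix X assume "X \<in> Pow \<U>"
      then have "X = ?X \<longleftrightarrow> e ?X = e X" using e[of ?X X] by auto
      moreover have "\<bar>real (e ?X) - real (e X)\<bar> \<ge> 1" if "e ?X \<noteq> e X"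
        using that by linarith
      ultimately show "of_bool (U \<in> X) * max 0 (1 - \<bar>real (e ?X) - real (e X)\<bar>)
          = (if X = ?X then of_bool (U \<in> X) else 0)"
        by auto
    qed
    also have "\<dots> = of_bool (U \<in> ?X)" using assms(1) by (subst sum.delta) auto
    finally show "\<phi> U (\<xi> x) = indicator U x" using U by (simp add: indicator_def)
  qed
qed

text \<open>Compared with \<open>lincomb\<close>, only the coefficients h(T) are averaged; what
  remains is a deterministic function of the event values u, hence of a single real variable once
  these are decoded from it.\<close>

definition mean_lincomb ::
    "'a measure \<Rightarrow> ('a \<Rightarrow> 'i \<Rightarrow> real) \<Rightarrow> ((('i \<Rightarrow> real) \<Rightarrow> real) \<times> 'b set) list \<Rightarrow> ('b set \<Rightarrow> real) \<Rightarrow> real" where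
  "mean_lincomb M T ws u = (\<Sum>(h, U)\<leftarrow>ws. (\<integral>x. h (T x) \<partial>M) * u U)"

lemma mean_lincomb_Nil [simp]: "mean_lincomb M T [] u = 0"
  and mean_lincomb_Cons [simp]:
    "mean_lincomb M T ((h, U) # ws) u = (\<integral>x. h (T x) \<partial>M) * u U + mean_lincomb M T ws u"
  by (simp_all add: mean_lincomb_def)

lemma mean_lincomb_bounded:
  fixes ws :: "((('i \<Rightarrow> real) \<Rightarrow> real) \<times> 'b set) list"
  shows "\<exists>C. \<forall>u. (\<forall>U. \<bar>u U\<bar> \<le> D) \<longrightarrow> \<bar>mean_lincomb M T ws u\<bar> \<le> C"
proof (induction ws)
  case (Cons w ws)
  obtain h U where w: "w = (h, U)" by (cases w)
  obtain C where C: "\<forall>u. (\<forall>U. \<bar>u U\<bar> \<le> D) \<longrightarrow> \<bar>mean_lincomb M T ws u\<bar> \<le> C" using Cons by blast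
  let ?c = "\<integral>x. h (T x) \<partial>M"
  have "\<bar>mean_lincomb M T (w # ws) u\<bar> \<le> \<bar>?c\<bar> * D + C" if u: "\<forall>U. \<bar>u U\<bar> \<le> D" for u
  proof -
    have "\<bar>?c * u U\<bar> \<le> \<bar>?c\<bar> * D" unfolding abs_mult using u by (intro mult_left_mono) auto
    moreover have "\<bar>mean_lincomb M T ws u\<bar> \<le> C" using C u by blast
    ultimately show ?thesis by (simp add: w)
  qed
  then show ?case by blast
qed (intro exI[of _ 0], simp)

lemma borel_measurable_mean_lincomb:
  "(\<And>U. (\<lambda>x. u x U) \<in> borel_measurable A) \<Longrightarrow> (\<lambda>x. mean_lincomb M T ws (u x)) \<in> borel_measurable A"
proof (induction ws)
  case (Cons w ws)
  then show ?case by (cases w) auto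
qed auto

lemma continuous_on_mean_lincomb:
  "(\<And>U. continuous_on S (\<lambda>y. u y U)) \<Longrightarrow> continuous_on S (\<lambda>y. mean_lincomb M T ws (u y))"
proof (induction ws)
  case (Cons w ws)
  then show ?case by (cases w) (auto intro!: continuous_intros)
qed auto

text \<open>Only the finitely many coefficients vary with n, so closeness is uniform over all u
  bounded by D. Uniformity is essential, as u will be evaluated at the random xi_n, which itself
  changes with n.\<close>

lemma eventually_mean_lincomb_close:
  fixes ws :: "((('i \<Rightarrow> real) \<Rightarrow> real) \<times> 'b set) list"
  assumes "\<And>h U. (h, U) \<in> set ws \<Longrightarrow> (\<lambda>n. \<integral>x. h (Tn n x) \<partial>Mn n) \<longlonglongrightarrow> (\<integral>x. h (T x) \<partial>M)" "0 < e"
  shows "\<forall>\<^sub>F n in sequentially. \<forall>u. (\<forall>U. \<bar>u U\<bar> \<le> D) \<longrightarrow>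
    \<bar>mean_lincomb (Mn n) (Tn n) ws u - mean_lincomb M T ws u\<bar> < e"
  using assms
proof (induction ws arbitrary: e)
  case (Cons w ws)
  obtain h U where w: "w = (h, U)" by (cases w)
  \<comment> \<open>Half of e goes to the head of the list and half to its tail; |D| + 1 is a
    positive bound for the event values.\<close>
  have D: "0 < e / (2 * (\<bar>D\<bar> + 1))" using Cons.prems(2) by auto
  have "(\<lambda>n. \<integral>x. h (Tn n x) \<partial>Mn n) \<longlonglongrightarrow> (\<integral>x. h (T x) \<partial>M)" using Cons.prems(1) by (auto simp: w)
  from tendstoD[OF this D]
  have 1: "\<forall>\<^sub>F n in sequentially. \<bar>(\<integral>x. h (Tn n x) \<partial>Mn n) - (\<integral>x. h (T x) \<partial>M)\<bar> < e / (2 * (\<bar>D\<bar> + 1))"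
    by (simp add: dist_real_def)
  have 2: "\<forall>\<^sub>F n in sequentially. \<forall>u. (\<forall>U. \<bar>u U\<bar> \<le> D) \<longrightarrow>
    \<bar>mean_lincomb (Mn n) (Tn n) ws u - mean_lincomb M T ws u\<bar> < e / 2"
    by (rule Cons.IH) (use Cons.prems in auto)
  from 1 2 show ?case
  proof eventually_elim
    case (elim n)
    let ?a = "(\<integral>x. h (Tn n x) \<partial>Mn n) - (\<integral>x. h (T x) \<partial>M)"
    show ?case
    proof (intro allI impI)
      fix u :: "'b set \<Rightarrow> real" assume u: "\<forall>U. \<bar>u U\<bar> \<le> D"
      have "\<bar>?a * u U\<bar> \<le> e / (2 * (\<bar>D\<bar> + 1)) * (\<bar>D\<bar> + 1)"
        unfolding abs_mult using elim(1) u[rule_format, of U] by (intro mult_mono) auto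
      also have "\<dots> = e / 2"
      proof -
        have "\<bar>D\<bar> + 1 \<noteq> 0" by linarith
        from nonzero_mult_divide_mult_cancel_right[OF this, of e 2] show ?thesis by simp
      qed
      finally have "\<bar>?a * u U\<bar> \<le> e / 2" .
      moreover have "\<bar>mean_lincomb (Mn n) (Tn n) ws u - mean_lincomb M T ws u\<bar> < e / 2"
        using elim(2) u by blast
      ultimately show "\<bar>mean_lincomb (Mn n) (Tn n) (w # ws) u - mean_lincomb M T (w # ws) u\<bar> < e"
        unfolding w mean_lincomb_Cons left_diff_distrib by linarith
    qed
  qed
qed simp

text \<open>By independence, integrating out the nuisance likelihood ratios is conditioning on the
  ancillary \<open>\<sigma>\<close>-field, and conditioning contracts the \<open>L\<^sup>1\<close> distance; the sign of the difference on
  the left serves as the test function.\<close>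

lemma restricted_likelihood_ratio_approx:
  fixes P :: "'i \<Rightarrow> 'a measure" and \<nu> :: "'j \<Rightarrow> 'i" and ws :: "((('i \<Rightarrow> real) \<Rightarrow> real) \<times> 'b set) list"
  assumes E: "statistical_experiment B P" and b: "b = \<nu> j0"
    and suff: "sufficient B (\<lambda>j. P (\<nu> j)) S" and compl: "boundedly_complete B (\<lambda>j. P (\<nu> j)) S"
    and anc: "ancillary B (\<lambda>j. P (\<nu> j)) A"
    and ws: "lincomb_over (range \<nu>) A' ws"
    and u: "\<And>U. (\<lambda>x. u x U) \<in> borel_measurable A" "\<And>x U. \<bar>u x U\<bar> \<le> D"
  defines "T \<equiv> \<lambda>x i. likelihood_ratio (P i) (P b) x"
    and "R \<equiv> \<lambda>x i. likelihood_ratio (restriction P A i) (restriction P A b) x"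
  shows "(\<integral>x. \<bar>R x i - mean_lincomb (P b) T ws (u x)\<bar> \<partial>P b) \<le> (\<integral>x. \<bar>T x i - lincomb ws (T x) (u x)\<bar> \<partial>P b)"
proof -
  have subA: "subalgebra B A" using anc by (simp add: ancillary_def)
  note ER = statistical_experiment_restriction[OF E subA]
  note mA = measurable_from_subalg[OF subA]
  note mP = measurable_experimentI[OF E]
  have mT: "(\<lambda>x. T x i) \<in> borel_measurable B" for i
    unfolding T_def by (rule measurable_likelihood_ratio[OF E])
  have mR: "(\<lambda>x. R x i) \<in> borel_measurable A"
    unfolding R_def by (rule measurable_likelihood_ratio[OF ER])
  let ?m = "\<lambda>x. mean_lincomb (P b) T ws (u x)" and ?W = "\<lambda>x. lincomb ws (T x) (u x)"
  have mm: "?m \<in> borel_measurable A" by (rule borel_measurable_mean_lincomb) (rule u)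
  have mW: "lincomb_over (range \<nu>) A' vs \<Longrightarrow> (\<lambda>x. lincomb vs (T x) (u x)) \<in> borel_measurable B" for vs
    by (rule borel_measurable_lincomb) (rule mT mA u | assumption)+
  obtain K where K: "\<And>x. \<bar>?m x\<bar> \<le> K" using mean_lincomb_bounded[of D "P b" T ws] u(2) by metis
  have iT: "integrable (P b) (\<lambda>x. T x i)"
    unfolding T_def by (rule integrable_likelihood_ratio[OF E])
  have iR: "integrable (P b) (\<lambda>x. R x i)"
    unfolding R_def by (rule integrable_restriction[OF E subA integrable_likelihood_ratio[OF ER]])
  have im: "integrable (P b) ?m" by (rule integrable_experiment[OF E mA[OF mm] K])
  have bW: "\<exists>C\<ge>0. \<forall>x. \<bar>lincomb vs (T x) (u x)\<bar> \<le> C" if "lincomb_over (range \<nu>) A' vs" for vs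
    using lincomb_bounded[OF that, of D] u(2) by blast
  \<comment> \<open>Both R and the averaged combination are \<open>A\<close>-measurable, hence so is
    s. Integrated against s, the restricted likelihood ratio may therefore be exchanged for the full
    one, and the averaged combination for the original one.\<close>
  define s where "s x = sgn (R x i - ?m x)" for x
  have ms: "s \<in> borel_measurable A" unfolding s_def using mR mm by measurable
  have s1: "\<bar>s x\<bar> \<le> 1" for x by (simp add: s_def abs_sgn_eq)
  have is_s: "integrable (P b) (\<lambda>x. Z x * s x)" if "integrable (P b) Z" for Z
  proof (rule Bochner_Integration.integrable_bound[OF that])
    show "AE x in P b. norm (Z x * s x) \<le> norm (Z x)"
      using s1 by (auto simp: abs_mult intro!: AE_I2 mult_right_le_one_le)
    show "(\<lambda>x. Z x * s x) \<in> borel_measurable (P b)"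
      by (rule borel_measurable_times[OF borel_measurable_integrable[OF that] mP[OF mA[OF ms]]])
  qed
  have iW: "integrable (P b) (\<lambda>x. lincomb vs (T x) (u x))" if "lincomb_over (range \<nu>) A' vs" for vs
    using bW[OF that] integrable_experiment[OF E mW[OF that]] by blast
  have Ws: "(\<integral>x. lincomb ws (T x) (u x) * s x \<partial>P b) = (\<integral>x. mean_lincomb (P b) T ws (u x) * s x \<partial>P b)"
    using ws
  proof (induction ws)
    case (Cons w vs)
    obtain h U where w: "w = (h, U)" by (cases w)
    have h: "cylindrical (range \<nu>) h" and vs: "lincomb_over (range \<nu>) A' vs"
      using Cons.prems by (auto simp: w)
    obtain C where C: "\<And>t. \<bar>h t\<bar> \<le> C" using cylindrical_bounded[OF h] by auto
    have mh: "(\<lambda>x. h (T x)) \<in> borel_measurable B" by (rule borel_measurable_cylindrical[OF h mT])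
    have us: "(\<lambda>x. u x U * s x) \<in> borel_measurable A" using u(1) ms by auto
    have us1: "\<bar>u x U * s x\<bar> \<le> D" for x
      using mult_mono[OF u(2)[of x U] s1[of x]] order_trans[OF abs_ge_zero u(2)[of x U]]
      by (simp add: abs_mult)
    have ih: "integrable (P b) (\<lambda>x. h (T x) * (u x U * s x))"
    proof (rule integrable_experiment[OF E, where C = "C * D"])
      show "\<bar>h (T x) * (u x U * s x)\<bar> \<le> C * D" for x
        unfolding abs_mult[of "h (T x)"] using order_trans[OF abs_ge_zero C]
        by (intro mult_mono C us1) auto
    qed (use mh mA[OF us] in auto)
    have ius: "integrable (P b) (\<lambda>x. u x U * s x)" by (rule integrable_experiment[OF E mA[OF us] us1])
    obtain K' where K': "\<And>x. \<bar>mean_lincomb (P b) T vs (u x)\<bar> \<le> K'"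
      using mean_lincomb_bounded[of D "P b" T vs] u(2) by metis
    have imv: "integrable (P b) (\<lambda>x. mean_lincomb (P b) T vs (u x) * s x)"
      by (rule is_s, rule integrable_experiment[OF E mA K'])
        (rule borel_measurable_mean_lincomb, rule u)
    have "(\<integral>x. lincomb (w # vs) (T x) (u x) * s x \<partial>P b)
        = (\<integral>x. h (T x) * (u x U * s x) + lincomb vs (T x) (u x) * s x \<partial>P b)"
      by (simp add: w algebra_simps)
    also have "\<dots> = (\<integral>x. h (T x) * (u x U * s x) \<partial>P b) + (\<integral>x. lincomb vs (T x) (u x) * s x \<partial>P b)"
      by (rule Bochner_Integration.integral_add[OF ih is_s[OF iW[OF vs]]])
    \<comment> \<open>The event value and the sign together form one bounded
      \<open>A\<close>-measurable variable, so Basu's theorem splits off the mean of h(T).\<close>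
    also have "(\<integral>x. h (T x) * (u x U * s x) \<partial>P b) = (\<integral>x. h (T x) \<partial>P b) * (\<integral>x. u x U * s x \<partial>P b)"
      unfolding T_def by (rule basu_likelihood_ratios[OF E b suff compl anc h us us1])
    also have "\<dots> + (\<integral>x. lincomb vs (T x) (u x) * s x \<partial>P b)
        = (\<integral>x. (\<integral>x. h (T x) \<partial>P b) * (u x U * s x) \<partial>P b) + (\<integral>x. mean_lincomb (P b) T vs (u x) * s x \<partial>P b)"
      using Cons.IH[OF vs] by simp
    also have "\<dots> = (\<integral>x. (\<integral>x. h (T x) \<partial>P b) * (u x U * s x) + mean_lincomb (P b) T vs (u x) * s x \<partial>P b)"
      by (rule Bochner_Integration.integral_add[symmetric]) (use ius imv in auto)
    also have "\<dots> = (\<integral>x. mean_lincomb (P b) T (w # vs) (u x) * s x \<partial>P b)"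
      by (simp add: w algebra_simps)
    finally show ?case .
  qed simp
  have "(\<integral>x. \<bar>R x i - ?m x\<bar> \<partial>P b) = (\<integral>x. R x i * s x - ?m x * s x \<partial>P b)"
    by (rule Bochner_Integration.integral_cong[OF refl]) (simp add: s_def abs_sgn left_diff_distrib)
  also have "\<dots> = (\<integral>x. R x i * s x \<partial>P b) - (\<integral>x. ?m x * s x \<partial>P b)"
    by (rule Bochner_Integration.integral_diff[OF is_s[OF iR] is_s[OF im]])
  also have "(\<integral>x. R x i * s x \<partial>P b) = (\<integral>x. T x i * s x \<partial>P b)"
    unfolding R_def T_def by (rule integral_likelihood_ratio_restriction[OF E subA ms])
  also have "(\<integral>x. ?m x * s x \<partial>P b) = (\<integral>x. ?W x * s x \<partial>P b)" by (rule Ws[symmetric])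
  also have "(\<integral>x. T x i * s x \<partial>P b) - (\<integral>x. ?W x * s x \<partial>P b) = (\<integral>x. T x i * s x - ?W x * s x \<partial>P b)"
    by (rule Bochner_Integration.integral_diff[OF is_s[OF iT] is_s[OF iW[OF ws]], symmetric])
  also have "\<dots> \<le> (\<integral>x. \<bar>T x i - ?W x\<bar> \<partial>P b)"
  proof (rule integral_mono)
    fix x
    have "T x i * s x - ?W x * s x \<le> \<bar>(T x i - ?W x) * s x\<bar>" by (simp add: left_diff_distrib)
    also have "\<dots> \<le> \<bar>T x i - ?W x\<bar>"
      unfolding abs_mult using s1 by (intro mult_right_le_one_le) auto
    finally show "T x i * s x - ?W x * s x \<le> \<bar>T x i - ?W x\<bar>" .
  qed (use is_s[OF iT] is_s[OF iW[OF ws]] iT iW[OF ws] in auto)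
  finally show ?thesis .
qed

section \<open>Transport of the approximations along the sequence\<close>

lemma integral_lipschitz_diff:
  assumes M: "prob_space M"
    and F: "F \<in> borel_measurable (PiM J (\<lambda>_. borel))" "\<And>t. \<bar>F t\<bar> \<le> C"
      "\<And>s t. \<bar>F s - F t\<bar> \<le> k * (\<Sum>i\<in>J. \<bar>s i - t i\<bar>)" "0 \<le> k"
    and X: "\<And>i. i \<in> J \<Longrightarrow> integrable M (\<lambda>x. X x i)" and Y: "\<And>i. i \<in> J \<Longrightarrow> integrable M (\<lambda>x. Y x i)"
    and d: "\<And>i. i \<in> J \<Longrightarrow> (\<integral>x. \<bar>X x i - Y x i\<bar> \<partial>M) \<le> d"
  shows "\<bar>(\<integral>x. F (restrict (X x) J) \<partial>M) - (\<integral>x. F (restrict (Y x) J) \<partial>M)\<bar> \<le> k * (real (card J) * d)"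
proof -
  interpret prob_space M by (rule M)
  have iF: "integrable M (\<lambda>x. F (restrict (Z x) J))" if "\<And>i. i \<in> J \<Longrightarrow> integrable M (\<lambda>x. Z x i)" for Z
  proof (rule integrable_const_bound[where B = C])
    have "(\<lambda>x. restrict (Z x) J) \<in> measurable M (PiM J (\<lambda>_. borel))"
      by (rule measurable_restrict) (rule borel_measurable_integrable[OF that])
    then show "(\<lambda>x. F (restrict (Z x) J)) \<in> borel_measurable M" by (rule measurable_compose[OF _ F(1)])
  qed (use F(2) in auto)
  have "(\<integral>x. F (restrict (X x) J) \<partial>M) - (\<integral>x. F (restrict (Y x) J) \<partial>M)
      = (\<integral>x. F (restrict (X x) J) - F (restrict (Y x) J) \<partial>M)"
    by (rule Bochner_Integration.integral_diff[OF iF[OF X] iF[OF Y], symmetric])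
  also have "\<bar>\<dots>\<bar> \<le> (\<integral>x. \<bar>F (restrict (X x) J) - F (restrict (Y x) J)\<bar> \<partial>M)"
    by (rule integral_abs_bound)
  also have "\<dots> \<le> (\<integral>x. k * (\<Sum>i\<in>J. \<bar>X x i - Y x i\<bar>) \<partial>M)"
  proof (rule integral_mono)
    show "integrable M (\<lambda>x. \<bar>F (restrict (X x) J) - F (restrict (Y x) J)\<bar>)"
      using iF[OF X] iF[OF Y] by auto
    show "integrable M (\<lambda>x. k * (\<Sum>i\<in>J. \<bar>X x i - Y x i\<bar>))"
      using X Y by (intro integrable_mult_right Bochner_Integration.integrable_sum) auto
    show "\<bar>F (restrict (X x) J) - F (restrict (Y x) J)\<bar> \<le> k * (\<Sum>i\<in>J. \<bar>X x i - Y x i\<bar>)" for x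
      using F(3)[of "restrict (X x) J" "restrict (Y x) J"] by simp
  qed
  also have "\<dots> = k * (\<Sum>i\<in>J. \<integral>x. \<bar>X x i - Y x i\<bar> \<partial>M)"
    using X Y by (simp add: Bochner_Integration.integral_sum)
  also have "\<dots> \<le> k * (real (card J) * d)"
    using sum_bounded_above[of J, OF d] F(4) by (intro mult_left_mono) auto
  finally show ?thesis .
qed

lemma lincomb_over_mono: "lincomb_over N A ws \<Longrightarrow> N \<subseteq> N' \<Longrightarrow> lincomb_over N' A ws"
  unfolding lincomb_over_def using cylindrical_mono by fastforce

lemma lincomb_over_finite:
  assumes "lincomb_over N A ws"
  shows "\<exists>J. finite J \<and> lincomb_over J A ws"
  using assms
proof (induction ws)
  case (Cons w ws)
  obtain h U where w: "w = (h, U)" by (cases w)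
  obtain J where J: "finite J" "lincomb_over J A ws" using Cons by (auto simp: w)
  obtain J' where J': "finite J'" "cylindrical J' h"
    using cylindrical_finite[of N h] Cons.prems by (auto simp: w)
  have "lincomb_over (J \<union> J') A ws" using J(2) by (rule lincomb_over_mono) simp
  moreover have "cylindrical (J \<union> J') h" using J'(2) by (rule cylindrical_mono) simp
  ultimately show ?case using Cons.prems J(1) J'(1) by (intro exI[of _ "J \<union> J'"]) (simp add: w)
qed (intro exI[of _ "{}"], simp)

lemma lincomb_restrict:
  "lincomb_over J0 A ws \<Longrightarrow> J0 \<subseteq> J \<Longrightarrow> lincomb ws (restrict t J) u = lincomb ws t u"
proof (induction ws)
  case (Cons w ws)
  obtain h U where w: "w = (h, U)" by (cases w)
  have "h (restrict t J) = h t"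
    using Cons.prems by (intro cylindrical_restrict) (auto simp: w)
  moreover have "lincomb ws (restrict t J) u = lincomb ws t u"
    by (rule Cons.IH) (use Cons.prems in \<open>auto simp: w\<close>)
  ultimately show ?case unfolding w lincomb_Cons by (simp only:)
qed simp

lemma lincomb_cong:
  "(\<And>U. U \<in> snd ` set ws \<Longrightarrow> u U = u' U) \<Longrightarrow> lincomb ws t u = lincomb ws t u'"
proof (induction ws)
  case (Cons w ws)
  then show ?case by (cases w) simp
qed simp

text \<open>With indicators replaced by continuous functions of y, the combination becomes jointly
  continuous in the likelihood ratios and the ancillary variable, as a test function for weak
  convergence must be.\<close>

lemma continuous_map_lincomb:
  assumes "lincomb_over J0 A ws" "J0 \<subseteq> J" "\<And>U. continuous_on UNIV (\<phi> U)"
  shows "continuous_map (prod_topology (powertop_real J) euclideanreal) euclideanreal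
    (\<lambda>p. lincomb ws (fst p) (\<lambda>U. \<phi> U (snd p)))"
  using assms(1)
proof (induction ws)
  case (Cons w ws)
  obtain h U where w: "w = (h, U)" by (cases w)
  have "continuous_map (powertop_real J) euclideanreal h"
    using Cons.prems assms(2) by (intro continuous_map_cylindrical) (auto simp: w)
  from continuous_map_compose[OF continuous_map_fst this] have 1: "continuous_map (prod_topology (powertop_real J) euclideanreal) euclideanreal (\<lambda>p. h (fst p))"
    by (simp add: o_def)
  have "continuous_map euclideanreal euclideanreal (\<phi> U)" using assms(3) by simp
  from continuous_map_compose[OF continuous_map_snd this] have 2: "continuous_map (prod_topology (powertop_real J) euclideanreal) euclideanreal (\<lambda>p. \<phi> U (snd p))"
    by (simp add: o_def)
  show ?case
    unfolding w lincomb_Cons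
    by (intro continuous_map_add continuous_map_real_mult 1 2 Cons.IH) (use Cons.prems in \<open>simp add: w\<close>)
qed simp

text \<open>Nonnegative variables of mean one are uniformly integrable as soon as their truncations
  converge in mean.\<close>

lemma eventually_L1_close:
  fixes Xn Yn :: "nat \<Rightarrow> 'a \<Rightarrow> real" and X Y :: "'b \<Rightarrow> real"
  assumes Xn: "\<And>n x. 0 \<le> Xn n x" "\<And>n. integrable (Mn n) (Xn n)" "\<And>n. (\<integral>x. Xn n x \<partial>Mn n) = 1"
    and X: "\<And>x. 0 \<le> X x" "integrable M X" "(\<integral>x. X x \<partial>M) = 1"
    and Yn: "\<And>n. integrable (Mn n) (Yn n)" and Y: "integrable M Y"
    and 1: "\<And>c. 0 \<le> c \<Longrightarrow> (\<lambda>n. \<integral>x. min (Xn n x) c \<partial>Mn n) \<longlonglongrightarrow> (\<integral>x. min (X x) c \<partial>M)"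
    and 2: "\<And>c. 0 \<le> c \<Longrightarrow> (\<lambda>n. \<integral>x. \<bar>min (Xn n x) c - Yn n x\<bar> \<partial>Mn n) \<longlonglongrightarrow> (\<integral>x. \<bar>min (X x) c - Y x\<bar> \<partial>M)"
    and e: "(\<integral>x. \<bar>X x - Y x\<bar> \<partial>M) < e"
  shows "\<forall>\<^sub>F n in sequentially. (\<integral>x. \<bar>Xn n x - Yn n x\<bar> \<partial>Mn n) < 3 * e"
proof -
  have imin: "integrable N (\<lambda>x. min (Z x) c)" if "integrable N Z" "\<And>x. 0 \<le> Z x" "0 \<le> c"
    for N :: "'c measure" and Z :: "'c \<Rightarrow> real" and c :: real
    by (rule Bochner_Integration.integrable_bound[OF that(1)])
      (use that in \<open>auto intro!: AE_I2 borel_measurable_min\<close>)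
  have e0: "0 < e"
    using e by (rule le_less_trans[rotated]) (rule Bochner_Integration.integral_nonneg, simp)
  have "(\<lambda>m. \<integral>x. min (X x) (real m) \<partial>M) \<longlonglongrightarrow> (\<integral>x. X x \<partial>M)"
  proof (rule integral_dominated_convergence[where w = X])
    show "AE x in M. (\<lambda>m. min (X x) (real m)) \<longlonglongrightarrow> X x"
    proof (rule AE_I2)
      fix x
      obtain m0 where "X x \<le> real m0" using real_arch_simple by blast
      then have "\<forall>\<^sub>F m in sequentially. min (X x) (real m) = X x"
        by (intro eventually_sequentiallyI[of m0]) auto
      then show "(\<lambda>m. min (X x) (real m)) \<longlonglongrightarrow> X x" by (rule tendsto_eventually)
    qed
  qed (use X in \<open>auto intro!: borel_measurable_min\<close>)
  \<comment> \<open>The truncation level is chosen in the limit, so that cutting X loses less than e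
    of its mean 1.\<close>
  then have "\<forall>\<^sub>F m in sequentially. 1 - e < (\<integral>x. min (X x) (real m) \<partial>M)"
    by (rule order_tendstoD(1)) (use X(3) e0 in simp)
  then obtain m where m: "1 - e < (\<integral>x. min (X x) (real m) \<partial>M)" by (auto simp: eventually_sequentially)
  define c where "c = real m"
  have c: "0 \<le> c" by (simp add: c_def)
  note iX = imin[OF X(2) X(1) c] and iXn = imin[OF Xn(2) Xn(1) c]
  \<comment> \<open>In the limit the truncated error is below 2e: e for the original error and e for
    the truncation.\<close>
  have "(\<integral>x. \<bar>min (X x) c - Y x\<bar> \<partial>M) \<le> (\<integral>x. \<bar>X x - Y x\<bar> + (X x - min (X x) c) \<partial>M)"
    using iX X Y by (intro integral_mono) auto
  also have "\<dots> = (\<integral>x. \<bar>X x - Y x\<bar> \<partial>M) + ((\<integral>x. X x \<partial>M) - (\<integral>x. min (X x) c \<partial>M))"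
    using iX X(2) Y by (simp add: Bochner_Integration.integral_add Bochner_Integration.integral_diff)
  also have "\<dots> < 2 * e" using e m X(3) by (simp add: c_def)
  finally have "\<forall>\<^sub>F n in sequentially. (\<integral>x. \<bar>min (Xn n x) c - Yn n x\<bar> \<partial>Mn n) < 2 * e"
    by (rule order_tendstoD(2)[OF 2[OF c]])
  moreover have "\<forall>\<^sub>F n in sequentially. 1 - e < (\<integral>x. min (Xn n x) c \<partial>Mn n)"
    by (rule order_tendstoD(1)[OF 1[OF c]]) (use m in \<open>simp add: c_def\<close>)
  ultimately show ?thesis
  proof eventually_elim
    case (elim n)
    \<comment> \<open>The third e undoes the truncation along the sequence: the tail has mean 1
      minus the truncated mean, since Xn has mean exactly 1.\<close>
    have "(\<integral>x. \<bar>Xn n x - Yn n x\<bar> \<partial>Mn n) \<le> (\<integral>x. \<bar>min (Xn n x) c - Yn n x\<bar> + (Xn n x - min (Xn n x) c) \<partial>Mn n)"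
      using iXn[of n] Xn(2)[of n] Yn[of n] by (intro integral_mono) auto
    also have "\<dots> = (\<integral>x. \<bar>min (Xn n x) c - Yn n x\<bar> \<partial>Mn n) + ((\<integral>x. Xn n x \<partial>Mn n) - (\<integral>x. min (Xn n x) c \<partial>Mn n))"
      using iXn[of n] Xn(2)[of n] Yn[of n]
      by (simp add: Bochner_Integration.integral_add Bochner_Integration.integral_diff)
    also have "\<dots> < 3 * e" using elim Xn(3)[of n] by simp
    finally show ?case .
  qed
qed

lemma rv_convD:
  assumes "rv_conv b Pn P \<xi>n \<xi>" "finite J"
    and "continuous_map (prod_topology (powertop_real J) euclideanreal) euclideanreal (\<lambda>p. f (fst p) (snd p))"
    and "\<And>t y. \<bar>f t y\<bar> \<le> C"
  shows "(\<lambda>n. \<integral>x. f (\<lambda>i\<in>J. likelihood_ratio (Pn n i) (Pn n b) x) (\<xi>n n x) \<partial>Pn n b)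
    \<longlonglongrightarrow> (\<integral>x. f (\<lambda>i\<in>J. likelihood_ratio (P i) (P b) x) (\<xi> x) \<partial>P b)"
proof -
  have "bounded ((\<lambda>p. f (fst p) (snd p)) ` topspace (prod_topology (powertop_real J) euclideanreal))"
    using assms(4) by (intro boundedI[where B = C]) auto
  then show ?thesis
    using assms(1-3) unfolding rv_conv_def conv_in_distribution_def lr_vector_def by force
qed

text \<open>The nuisance subexperiment is the subfamily along \<open>\<nu>\<close>. The equation b =
  \<open>\<nu> j0\<close> puts the base point into it, so that nuisance likelihood ratios, null sets
  and Basu's theorem all refer to the measure under which convergence is stated.\<close>

lemma le_cam_conv_restriction_ancillary:
  fixes Pn :: "nat \<Rightarrow> 'i \<Rightarrow> 'a measure" and P :: "'i \<Rightarrow> 'b measure" and \<nu> :: "'j \<Rightarrow> 'i"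
  assumes En: "\<And>n. statistical_experiment (Bn n) (Pn n)" and E: "statistical_experiment B P"
    and b: "b = \<nu> j0"
    and suffn: "\<And>n. sufficient (Bn n) (\<lambda>j. Pn n (\<nu> j)) (Sn n)"
    and compln: "\<And>n. boundedly_complete (Bn n) (\<lambda>j. Pn n (\<nu> j)) (Sn n)"
    and ancn: "\<And>n. ancillary (Bn n) (\<lambda>j. Pn n (\<nu> j)) (An n)"
    and min: "minimal_sufficient B (\<lambda>j. P (\<nu> j)) S"
    and compl: "boundedly_complete B (\<lambda>j. P (\<nu> j)) S"
    and anc: "ancillary B (\<lambda>j. P (\<nu> j)) A"
    and gen: "jointly_generate B S A"
    and conv: "sigma_field_conv b Pn P An A"
  shows "le_cam_conv b (\<lambda>n. restriction (Pn n) (An n)) (restriction P A)"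
  unfolding le_cam_conv_def
proof (intro allI impI)
  fix J :: "'i set" assume J: "finite J"
  have subA: "subalgebra B A" using anc by (simp add: ancillary_def)
  have subAn: "subalgebra (Bn n) (An n)" for n using ancn by (simp add: ancillary_def)
  have suff: "sufficient B (\<lambda>j. P (\<nu> j)) S" using min by (simp add: minimal_sufficient_def)
  note ER = statistical_experiment_restriction[OF E subA]
  note ERn = statistical_experiment_restriction[OF En subAn]
  define T where "T = (\<lambda>x i. likelihood_ratio (P i) (P b) x)"
  define Tn where "Tn = (\<lambda>n x i. likelihood_ratio (Pn n i) (Pn n b) x)"
  define R where "R = (\<lambda>x i. likelihood_ratio (restriction P A i) (restriction P A b) x)"
  define Rn where "Rn =
    (\<lambda>n x i. likelihood_ratio (restriction (Pn n) (An n) i) (restriction (Pn n) (An n) b) x)"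
  have lr: "lr_vector b (restriction P A) J = (\<lambda>x. restrict (R x) J)"
    "lr_vector b (restriction (Pn n) (An n)) J = (\<lambda>x. restrict (Rn n x) J)" for n
    unfolding lr_vector_def R_def Rn_def by (rule refl)+
  have mR: "(\<lambda>x. restrict (R x) J) \<in> measurable A (PiM J (\<lambda>_. borel))"
    unfolding R_def by (rule measurable_restrict) (rule measurable_likelihood_ratio[OF ER])
  have mRn: "(\<lambda>x. restrict (Rn n x) J) \<in> measurable (An n) (PiM J (\<lambda>_. borel))" for n
    unfolding Rn_def by (rule measurable_restrict) (rule measurable_likelihood_ratio[OF ERn])
  have iT: "integrable (P b) (\<lambda>x. T x i)" for i
    unfolding T_def by (rule integrable_likelihood_ratio[OF E])
  have iTn: "integrable (Pn n b) (\<lambda>x. Tn n x i)" for n i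
    unfolding Tn_def by (rule integrable_likelihood_ratio[OF En])
  have iR: "integrable (P b) (\<lambda>x. R x i)" for i
    unfolding R_def by (rule integrable_restriction[OF E subA integrable_likelihood_ratio[OF ER]])
  have iRn: "integrable (Pn n b) (\<lambda>x. Rn n x i)" for n i
    unfolding Rn_def by (rule integrable_restriction[OF En subAn integrable_likelihood_ratio[OF ERn]])
  have mT: "(\<lambda>x. T x i) \<in> borel_measurable B" for i
    unfolding T_def by (rule measurable_likelihood_ratio[OF E])
  have mTn: "(\<lambda>x. Tn n x i) \<in> borel_measurable (Bn n)" for n i
    unfolding Tn_def by (rule measurable_likelihood_ratio[OF En])
  interpret cylinder_approximation "P b" "range \<nu>" T A
    unfolding T_def by (rule cylinder_approximation_experiment[OF E subA])
  have appr: "approximable X" if "integrable (P b) X" for X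
    using approximable_integrable_experiment[OF E b min subA gen that] unfolding T_def .
  show "conv_in_distribution (powertop_real J) (\<lambda>n. restriction (Pn n) (An n) b)
     (\<lambda>n. lr_vector b (restriction (Pn n) (An n)) J) (restriction P A b) (lr_vector b (restriction P A) J)"
    unfolding lr
  proof (rule conv_in_distribution_lipschitzI[OF J])
    show "prob_space (restriction (Pn n) (An n) b)" for n by (rule statistical_experimentD(1)[OF ERn])
    show "prob_space (restriction P A b)" by (rule statistical_experimentD(1)[OF ER])
    show "(\<lambda>x. restrict (Rn n x) J) \<in> measurable (restriction (Pn n) (An n) b) (PiM J (\<lambda>_. borel))" for n
      by (rule measurable_experimentI[OF ERn mRn])
    show "(\<lambda>x. restrict (R x) J) \<in> measurable (restriction P A b) (PiM J (\<lambda>_. borel))"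
      by (rule measurable_experimentI[OF ER mR])
    fix F :: "('i \<Rightarrow> real) \<Rightarrow> real" and k C :: real
    assume F: "F \<in> borel_measurable (PiM J (\<lambda>_. borel))" "\<And>t. \<bar>F t\<bar> \<le> C"
      "\<And>s t. \<bar>F s - F t\<bar> \<le> k * (\<Sum>i\<in>J. \<bar>s i - t i\<bar>)" "0 \<le> k"
    have "(\<lambda>n. \<integral>x. F (restrict (Rn n x) J) \<partial>Pn n b) \<longlonglongrightarrow> (\<integral>x. F (restrict (R x) J) \<partial>P b)"
    proof (rule tendstoI)
      fix e :: real assume e: "0 < e"
      define K where "K = k * real (card J)"
      have K: "0 \<le> K" using F(4) by (simp add: K_def)
      \<comment> \<open>The three L1 comparisons at the end cost 3, 1 and 1 times \<epsilon> per
        coordinate, together 5 K \<epsilon> < e/2. The other half of e is left for the weak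
        convergence of xi_n.\<close>
      define \<epsilon> where "\<epsilon> = e / (10 * (K + 1))"
      have \<epsilon>: "0 < \<epsilon>" using e K by (simp add: \<epsilon>_def)
      have "\<exists>ws. lincomb_over (range \<nu>) A ws \<and> (\<integral>x. \<bar>T x i - comb ws x\<bar> \<partial>P b) < \<epsilon>" for i
        using appr[OF iT[of i]] \<epsilon> unfolding approximable_def by blast
      then obtain ws where ws: "\<And>i. lincomb_over (range \<nu>) A (ws i)"
        "\<And>i. (\<integral>x. \<bar>T x i - comb (ws i) x\<bar> \<partial>P b) < \<epsilon>" by metis
      \<comment> \<open>The events of all approximations for indices in J are gathered, so that one
        xi decodes every one of them.\<close>
      define \<U> where "\<U> = (\<Union>i\<in>J. snd ` set (ws i))"
      have "finite \<U>" using J by (auto simp: \<U>_def)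
      moreover have "\<U> \<subseteq> sets A" using ws(1) by (fastforce simp: \<U>_def lincomb_over_def)
      ultimately obtain \<xi> :: "'b \<Rightarrow> real" and \<phi> :: "'b set \<Rightarrow> real \<Rightarrow> real" and D where \<xi>: "\<xi> \<in> borel_measurable A"
        and \<phi>: "\<And>U. continuous_on UNIV (\<phi> U)" "\<And>U y. \<bar>\<phi> U y\<bar> \<le> D"
          "\<And>U x. U \<in> \<U> \<Longrightarrow> \<phi> U (\<xi> x) = indicator U x"
        by (rule encode_events) (rule that)
      obtain \<xi>n where \<xi>n: "\<And>n. \<xi>n n \<in> borel_measurable (An n)" and rv: "rv_conv b Pn P \<xi>n \<xi>"
        using conv \<xi> unfolding sigma_field_conv_def by blast
      have m\<phi>: "\<phi> U \<in> borel_measurable borel" for U by (rule borel_measurable_continuous_onI) (rule \<phi>)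
      have u: "(\<lambda>x. \<phi> U (\<xi> x)) \<in> borel_measurable A" for U by (rule measurable_compose[OF \<xi> m\<phi>])
      have un: "(\<lambda>x. \<phi> U (\<xi>n n x)) \<in> borel_measurable (An n)" for U n by (rule measurable_compose[OF \<xi>n m\<phi>])
      \<comment> \<open>G carries the limiting means and is the continuous function shared by limit
        and sequence; \<open>Gn\<close> carries the means at stage n, as conditioning there produces
        them.\<close>
      define G where "G y i = mean_lincomb (P b) T (ws i) (\<lambda>U. \<phi> U y)" for y i
      define Gn where "Gn n y i = mean_lincomb (Pn n b) (Tn n) (ws i) (\<lambda>U. \<phi> U y)" for n y i
      define W where "W x i = lincomb (ws i) (T x) (\<lambda>U. \<phi> U (\<xi> x))" for x i
      define Wn where "Wn n x i = lincomb (ws i) (Tn n x) (\<lambda>U. \<phi> U (\<xi>n n x))" for n x i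
      have Wbd: "\<exists>C\<ge>0. \<forall>t y. \<bar>lincomb (ws i) t (\<lambda>U. \<phi> U y)\<bar> \<le> C" for i
      proof -
        obtain C where C: "C \<ge> 0" "\<forall>t u. (\<forall>U. \<bar>u U\<bar> \<le> D) \<longrightarrow> \<bar>lincomb (ws i) t u\<bar> \<le> C"
          using lincomb_bounded[OF ws(1)[of i], of D] by blast
        have "\<bar>lincomb (ws i) t (\<lambda>U. \<phi> U y)\<bar> \<le> C" for t y
          by (rule C(2)[rule_format]) (rule \<phi>(2))
        with C(1) show ?thesis by blast
      qed
      have iW: "integrable (P b) (\<lambda>x. W x i)" for i
      proof -
        obtain C where "\<forall>t y. \<bar>lincomb (ws i) t (\<lambda>U. \<phi> U y)\<bar> \<le> C" using Wbd by blast
        moreover have "(\<lambda>x. W x i) \<in> borel_measurable B"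
          unfolding W_def by (rule borel_measurable_lincomb[OF ws(1) mT measurable_from_subalg[OF subA u]])
        ultimately show ?thesis by (intro integrable_experiment[OF E]) (auto simp: W_def)
      qed
      have iWn: "integrable (Pn n b) (\<lambda>x. Wn n x i)" for n i
      proof -
        obtain C where "\<forall>t y. \<bar>lincomb (ws i) t (\<lambda>U. \<phi> U y)\<bar> \<le> C" using Wbd by blast
        moreover have "(\<lambda>x. Wn n x i) \<in> borel_measurable (Bn n)"
          unfolding Wn_def by (rule borel_measurable_lincomb[OF ws(1) mTn measurable_from_subalg[OF subAn un]])
        ultimately show ?thesis by (intro integrable_experiment[OF En]) (auto simp: Wn_def)
      qed
      have iG: "integrable M (\<lambda>x. mean_lincomb M' T' (ws i) (\<lambda>U. \<phi> U (\<zeta> x)))"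
        if "prob_space M" "\<And>U. (\<lambda>x. \<phi> U (\<zeta> x)) \<in> borel_measurable M"
        for M :: "'c measure" and M' :: "'d measure" and T' i \<zeta>
      proof -
        interpret M: prob_space M by (rule that)
        obtain C where C: "\<forall>u. (\<forall>U. \<bar>u U\<bar> \<le> D) \<longrightarrow> \<bar>mean_lincomb M' T' (ws i) u\<bar> \<le> C"
          using mean_lincomb_bounded[of D M' T' "ws i"] by blast
        have "\<bar>mean_lincomb M' T' (ws i) (\<lambda>U. \<phi> U (\<zeta> x))\<bar> \<le> C" for x
          by (rule C[rule_format]) (rule \<phi>(2))
        then show ?thesis
          by (intro M.integrable_const_bound[where B = C] borel_measurable_mean_lincomb that(2)) simp
      qed
      have iG\<xi>: "integrable (P b) (\<lambda>x. G (\<xi> x) i)" for i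
        unfolding G_def
        by (rule iG[OF statistical_experimentD(1)[OF E] measurable_experimentI[OF E measurable_from_subalg[OF subA u]]])
      have iG\<xi>n: "integrable (Pn n b) (\<lambda>x. G (\<xi>n n x) i)" for n i
        unfolding G_def
        by (rule iG[OF statistical_experimentD(1)[OF En] measurable_experimentI[OF En measurable_from_subalg[OF subAn un]]])
      have iGn\<xi>n: "integrable (Pn n b) (\<lambda>x. Gn n (\<xi>n n x) i)" for n i
        unfolding Gn_def
        by (rule iG[OF statistical_experimentD(1)[OF En] measurable_experimentI[OF En measurable_from_subalg[OF subAn un]]])
      have "\<exists>J0. finite J0 \<and> lincomb_over J0 A (ws i)" for i by (rule lincomb_over_finite[OF ws(1)])
      then obtain J0 where J0: "\<And>i. finite (J0 i)" "\<And>i. lincomb_over (J0 i) A (ws i)" by metis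
      \<comment> \<open>J is enlarged by the nuisance coordinates occurring in the approximations,
        so that they and the targets L_i appear in one joint convergence statement.\<close>
      define J' where "J' = J \<union> (\<Union>i\<in>J. J0 i)"
      have J': "finite J'" "J \<subseteq> J'" "\<And>i. i \<in> J \<Longrightarrow> J0 i \<subseteq> J'" using J J0(1) by (auto simp: J'_def)
      note rvD = rv_convD[OF rv J'(1)]
      let ?TT = "prod_topology (powertop_real J') euclideanreal"
      have close: "(\<integral>x. \<bar>T x i - W x i\<bar> \<partial>P b) < \<epsilon>" if "i \<in> J" for i
      proof -
        have "W x i = comb (ws i) x" for x
          unfolding W_def by (rule lincomb_cong, rule \<phi>(3)) (use that in \<open>auto simp: \<U>_def\<close>)
        then show ?thesis using ws(2)[of i] by simp
      qed
      have closen: "\<forall>\<^sub>F n in sequentially. (\<integral>x. \<bar>Tn n x i - Wn n x i\<bar> \<partial>Pn n b) < 3 * \<epsilon>" if i: "i \<in> J" for i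
      proof (rule eventually_L1_close[OF _ iTn _ _ iT _ iWn iW _ _ close[OF i]])
        have iJ': "i \<in> J'" using i J' by auto
        have ci: "continuous_map ?TT euclideanreal (\<lambda>p. fst p i)"
          using continuous_map_compose[OF continuous_map_fst continuous_map_product_projection[OF iJ']]
          by (simp add: o_def)
        show "0 \<le> T x i" for x by (simp add: T_def likelihood_ratio_nonneg)
        show "0 \<le> Tn n x i" for n x by (simp add: Tn_def likelihood_ratio_nonneg)
        show "(\<integral>x. T x i \<partial>P b) = 1" unfolding T_def by (rule integral_likelihood_ratio_1[OF E])
        show "(\<integral>x. Tn n x i \<partial>Pn n b) = 1" for n unfolding Tn_def by (rule integral_likelihood_ratio_1[OF En])
        fix c :: real assume c: "0 \<le> c"
        \<comment> \<open>A test function must be bounded on the whole space, and the minimum with c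
          is unbounded below. Cutting at 0 as well changes nothing on likelihood ratios, which are
          nonnegative.\<close>
        have cm: "continuous_map ?TT euclideanreal (\<lambda>p. max 0 (min (fst p i) c))"
          by (intro continuous_map_real_max continuous_map_real_min ci) simp_all
        have nn: "max 0 (min (likelihood_ratio M N x) c) = min (likelihood_ratio M N x) c"
          for M N :: "'c measure" and x
          using likelihood_ratio_nonneg[of M N x] c by simp
        show "(\<lambda>n. \<integral>x. min (Tn n x i) c \<partial>Pn n b) \<longlonglongrightarrow> (\<integral>x. min (T x i) c \<partial>P b)"
          using rvD[of "\<lambda>t y. max 0 (min (t i) c)" c, OF cm] c iJ' by (simp add: nn T_def Tn_def)
        obtain C where C: "C \<ge> 0" "\<And>t y. \<bar>lincomb (ws i) t (\<lambda>U. \<phi> U y)\<bar> \<le> C" using Wbd by blast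
        have cm2: "continuous_map ?TT euclideanreal
            (\<lambda>p. \<bar>max 0 (min (fst p i) c) - lincomb (ws i) (fst p) (\<lambda>U. \<phi> U (snd p))\<bar>)"
          by (intro continuous_map_real_abs continuous_map_diff cm
              continuous_map_lincomb[OF J0(2) J'(3)[OF i] \<phi>(1)])
        have "\<bar>\<bar>max 0 (min (t i) c) - lincomb (ws i) t (\<lambda>U. \<phi> U y)\<bar>\<bar> \<le> c + C" for t y
          using C(2)[of t y] c by linarith
        from rvD[of "\<lambda>t y. \<bar>max 0 (min (t i) c) - lincomb (ws i) t (\<lambda>U. \<phi> U y)\<bar>", OF cm2 this]
        show "(\<lambda>n. \<integral>x. \<bar>min (Tn n x i) c - Wn n x i\<bar> \<partial>Pn n b) \<longlonglongrightarrow> (\<integral>x. \<bar>min (T x i) c - W x i\<bar> \<partial>P b)"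
          using iJ' by (simp add: nn lincomb_restrict[OF J0(2) J'(3)[OF i]] T_def Tn_def W_def Wn_def)
      qed
      have RG: "(\<integral>x. \<bar>R x i - G (\<xi> x) i\<bar> \<partial>P b) \<le> \<epsilon>" if "i \<in> J" for i
      proof -
        have "(\<integral>x. \<bar>R x i - G (\<xi> x) i\<bar> \<partial>P b) \<le> (\<integral>x. \<bar>T x i - W x i\<bar> \<partial>P b)"
          unfolding R_def G_def T_def W_def
          by (rule restricted_likelihood_ratio_approx[where u = "\<lambda>x U. \<phi> U (\<xi> x)",
              OF E b suff compl anc ws(1) u \<phi>(2)])
        with close[OF that] show ?thesis by simp
      qed
      have RGn: "(\<integral>x. \<bar>Rn n x i - Gn n (\<xi>n n x) i\<bar> \<partial>Pn n b) \<le> (\<integral>x. \<bar>Tn n x i - Wn n x i\<bar> \<partial>Pn n b)" for n i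
        unfolding Rn_def Gn_def Tn_def Wn_def
        by (rule restricted_likelihood_ratio_approx[where u = "\<lambda>x U. \<phi> U (\<xi>n n x)",
            OF En b suffn compln ancn ws(1) un \<phi>(2)])
      have mean: "(\<lambda>n. \<integral>x. h (Tn n x) \<partial>Pn n b) \<longlonglongrightarrow> (\<integral>x. h (T x) \<partial>P b)"
        if i: "i \<in> J" and hU: "(h, U) \<in> set (ws i)" for i h U
      proof -
        have h: "cylindrical (J0 i) h" using J0(2)[of i] hU by (auto simp: lincomb_over_def)
        obtain C where C: "\<And>t. \<bar>h t\<bar> \<le> C" using cylindrical_bounded[OF h] by auto
        have "continuous_map ?TT euclideanreal (\<lambda>p. h (fst p))"
          using continuous_map_compose[OF continuous_map_fst continuous_map_cylindrical[OF h J'(3)[OF i]]]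
          by (simp add: o_def)
        from rvD[of "\<lambda>t y. h t", OF this C] show ?thesis
          by (simp add: cylindrical_restrict[OF h J'(3)[OF i]] T_def Tn_def)
      qed
      have "\<forall>\<^sub>F n in sequentially. \<forall>i\<in>J. \<forall>y. \<bar>Gn n y i - G y i\<bar> < \<epsilon>"
      proof (rule eventually_ball_finite[OF J], rule ballI)
        fix i assume i: "i \<in> J"
        have "\<forall>\<^sub>F n in sequentially. \<forall>u. (\<forall>U. \<bar>u U\<bar> \<le> D) \<longrightarrow>
          \<bar>mean_lincomb (Pn n b) (Tn n) (ws i) u - mean_lincomb (P b) T (ws i) u\<bar> < \<epsilon>"
          by (rule eventually_mean_lincomb_close[OF mean[OF i] \<epsilon>])
        then show "\<forall>\<^sub>F n in sequentially. \<forall>y. \<bar>Gn n y i - G y i\<bar> < \<epsilon>"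
          by eventually_elim (use \<phi>(2) in \<open>simp add: Gn_def G_def\<close>)
      qed
      moreover have "\<forall>\<^sub>F n in sequentially. \<forall>i\<in>J. (\<integral>x. \<bar>Tn n x i - Wn n x i\<bar> \<partial>Pn n b) < 3 * \<epsilon>"
        by (rule eventually_ball_finite[OF J]) (use closen in blast)
      \<comment> \<open>Here F composed with G is a bounded continuous function of the ancillary
        variable alone, continuity coming from the Lipschitz bound on F; the convergence of xi_n to
        xi applies to it.\<close>
      moreover have "\<forall>\<^sub>F n in sequentially.
        \<bar>(\<integral>x. F (restrict (G (\<xi>n n x)) J) \<partial>Pn n b) - (\<integral>x. F (restrict (G (\<xi> x)) J) \<partial>P b)\<bar> < e / 2"
      proof -
        have cG: "continuous_on UNIV (\<lambda>y. G y i)" for i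
          unfolding G_def by (rule continuous_on_mean_lincomb) (rule \<phi>)
        have "continuous_on UNIV (\<lambda>y. F (restrict (G y) J))"
          unfolding continuous_on_def
        proof (intro ballI)
          fix y :: real
          have "((\<lambda>z. k * (\<Sum>i\<in>J. \<bar>G z i - G y i\<bar>)) \<longlongrightarrow> k * (\<Sum>i\<in>J. \<bar>G y i - G y i\<bar>)) (at y)"
            using cG by (intro tendsto_intros) (simp add: continuous_on_def)
          then have lim: "((\<lambda>z. k * (\<Sum>i\<in>J. \<bar>G z i - G y i\<bar>)) \<longlongrightarrow> 0) (at y)" by simp
          have bound: "norm (F (restrict (G z) J) - F (restrict (G y) J)) \<le> k * (\<Sum>i\<in>J. \<bar>G z i - G y i\<bar>)" for z
            using F(3)[of "restrict (G z) J" "restrict (G y) J"] by simp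
          have "((\<lambda>z. F (restrict (G z) J) - F (restrict (G y) J)) \<longlongrightarrow> 0) (at y)"
            by (rule Lim_null_comparison[OF always_eventually[OF allI[OF bound]] lim])
          then show "((\<lambda>z. F (restrict (G z) J)) \<longlongrightarrow> F (restrict (G y) J)) (at y)"
            by (simp add: LIM_zero_iff)
        qed
        then have "continuous_map euclideanreal euclideanreal (\<lambda>y. F (restrict (G y) J))" by simp
        from continuous_map_compose[OF continuous_map_snd this]
        have "continuous_map ?TT euclideanreal (\<lambda>p. F (restrict (G (snd p)) J))"
          by (simp add: o_def)
        from tendstoD[OF rvD[of "\<lambda>t y. F (restrict (G y) J)", OF this F(2)], of "e / 2"] e
        show ?thesis by (simp add: dist_real_def)
      qed
      ultimately show "\<forall>\<^sub>F n in sequentially.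
        dist (\<integral>x. F (restrict (Rn n x) J) \<partial>Pn n b) (\<integral>x. F (restrict (R x) J) \<partial>P b) < e"
      proof eventually_elim
        case (elim n)
        note prn = statistical_experimentD(1)[OF En]
        interpret n: prob_space "Pn n b" by (rule prn)
        \<comment> \<open>The path from the restricted likelihood ratios at stage n to those of the
          limit goes through \<open>Gn\<close> at xi_n, then G at xi_n, then G at xi. Every link but
          the third is an L1 estimate.\<close>
        have 1: "\<bar>(\<integral>x. F (restrict (Rn n x) J) \<partial>Pn n b) - (\<integral>x. F (restrict (Gn n (\<xi>n n x)) J) \<partial>Pn n b)\<bar>
            \<le> k * (real (card J) * (3 * \<epsilon>))"
        proof (rule integral_lipschitz_diff[OF prn F iRn iGn\<xi>n])
          show "(\<integral>x. \<bar>Rn n x i - Gn n (\<xi>n n x) i\<bar> \<partial>Pn n b) \<le> 3 * \<epsilon>" if "i \<in> J" for i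
            using RGn[of n i] elim(2) that by fastforce
        qed
        have 2: "\<bar>(\<integral>x. F (restrict (Gn n (\<xi>n n x)) J) \<partial>Pn n b) - (\<integral>x. F (restrict (G (\<xi>n n x)) J) \<partial>Pn n b)\<bar>
            \<le> k * (real (card J) * \<epsilon>)"
        proof (rule integral_lipschitz_diff[OF prn F iGn\<xi>n iG\<xi>n])
          fix i assume i: "i \<in> J"
          have "(\<integral>x. \<bar>Gn n (\<xi>n n x) i - G (\<xi>n n x) i\<bar> \<partial>Pn n b) \<le> (\<integral>x. \<epsilon> \<partial>Pn n b)"
            using elim(1) i iGn\<xi>n iG\<xi>n by (intro integral_mono) (auto intro: less_imp_le)
          then show "(\<integral>x. \<bar>Gn n (\<xi>n n x) i - G (\<xi>n n x) i\<bar> \<partial>Pn n b) \<le> \<epsilon>" by (simp add: n.prob_space)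
        qed
        have 3: "\<bar>(\<integral>x. F (restrict (R x) J) \<partial>P b) - (\<integral>x. F (restrict (G (\<xi> x)) J) \<partial>P b)\<bar>
            \<le> k * (real (card J) * \<epsilon>)"
          by (rule integral_lipschitz_diff[OF statistical_experimentD(1)[OF E] F iR iG\<xi> RG])
        have "k * (real (card J) * (3 * \<epsilon>)) + 2 * (k * (real (card J) * \<epsilon>)) = 5 * K * \<epsilon>"
          by (simp add: K_def)
        also have "\<dots> < 5 * (K + 1) * \<epsilon>" using \<epsilon> by simp
        also have "\<dots> = e / 2" using K by (simp add: \<epsilon>_def field_simps)
        finally show ?case using 1 2 3 elim(3) unfolding dist_real_def by linarith
      qed
    qed
    moreover have "(\<integral>x. F (restrict (Rn n x) J) \<partial>restriction (Pn n) (An n) b) = (\<integral>x. F (restrict (Rn n x) J) \<partial>Pn n b)" for n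
      by (rule integral_restriction[OF En subAn measurable_compose[OF mRn F(1)]])
    moreover have "(\<integral>x. F (restrict (R x) J) \<partial>restriction P A b) = (\<integral>x. F (restrict (R x) J) \<partial>P b)"
      by (rule integral_restriction[OF E subA measurable_compose[OF mR F(1)]])
    ultimately show "(\<lambda>n. \<integral>x. F (restrict (Rn n x) J) \<partial>restriction (Pn n) (An n) b)
        \<longlonglongrightarrow> (\<integral>x. F (restrict (R x) J) \<partial>restriction P A b)"
      by simp
  qed
qed

text \<open>The nuisance subfamily is that of the indices (0, \<eta>), and the base point (0, 0)
  belongs to it through \<eta> = 0.\<close>

theorem corollary2p1:
  fixes Bn Sn An :: "nat \<Rightarrow> 'a measure"
    and Pn :: "nat \<Rightarrow> (real ^ 'k) \<times> ('u::{real_vector,topological_space}) \<Rightarrow> 'a measure"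
    and B S A :: "'b measure"
    and P :: "(real ^ 'k) \<times> 'u \<Rightarrow> 'b measure"
  assumes "separable_inf_dim_tvs TYPE('u)"
    and "\<And>n. statistical_experiment (Bn n) (Pn n)"
    and "statistical_experiment B P"
    and "le_cam_conv (0, 0) Pn P"
    and "countably_generated B"
    and "minimal_sufficient B (\<lambda>\<eta>. P (0, \<eta>)) S"
    and "boundedly_complete B (\<lambda>\<eta>. P (0, \<eta>)) S"
    and "maximal_ancillary B (\<lambda>\<eta>. P (0, \<eta>)) A"
    and "jointly_generate B S A"
    and "\<And>A'. maximal_ancillary B (\<lambda>\<eta>. P (0, \<eta>)) A' \<Longrightarrow> jointly_generate B S A' \<Longrightarrow>
           eq_mod_null B (\<lambda>\<eta>. P (0, \<eta>)) A' A"
    and "\<And>n. minimal_sufficient (Bn n) (\<lambda>\<eta>. Pn n (0, \<eta>)) (Sn n)"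
    and "\<And>n. boundedly_complete (Bn n) (\<lambda>\<eta>. Pn n (0, \<eta>)) (Sn n)"
    and "\<And>n. maximal_ancillary (Bn n) (\<lambda>\<eta>. Pn n (0, \<eta>)) (An n)"
    and "\<And>n. jointly_generate (Bn n) (Sn n) (An n)"
    and "sigma_field_conv (0, 0) Pn P An A"
  shows "le_cam_conv (0, 0) (\<lambda>n. restriction (Pn n) (An n)) (restriction P A)"
proof (rule le_cam_conv_restriction_ancillary[where \<nu> = "\<lambda>\<eta>. (0, \<eta>)" and ?j0.0 = 0])
  show "statistical_experiment (Bn n) (Pn n)" for n by (rule assms(2))
  show "statistical_experiment B P" by (rule assms(3))
  show "sufficient (Bn n) (\<lambda>\<eta>. Pn n (0, \<eta>)) (Sn n)" for n
    using assms(11) by (simp add: minimal_sufficient_def)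
  show "boundedly_complete (Bn n) (\<lambda>\<eta>. Pn n (0, \<eta>)) (Sn n)" for n by (rule assms(12))
  show "ancillary (Bn n) (\<lambda>\<eta>. Pn n (0, \<eta>)) (An n)" for n
    using assms(13) by (simp add: maximal_ancillary_def)
  show "minimal_sufficient B (\<lambda>\<eta>. P (0, \<eta>)) S" by (rule assms(6))
  show "boundedly_complete B (\<lambda>\<eta>. P (0, \<eta>)) S" by (rule assms(7))
  show "ancillary B (\<lambda>\<eta>. P (0, \<eta>)) A" using assms(8) by (simp add: maximal_ancillary_def)
  show "jointly_generate B S A" by (rule assms(9))
  show "sigma_field_conv (0, 0) Pn P An A" by (rule assms(15))
qed (rule refl)

end
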